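(* Let $n\geq2$, and let $M$ be a monoid with group of units $G$ such that $\mathbb E(M)=\langle E(M)\rangle=\{1\}\cup(M\setminus G)$. Suppose $\mathbb E(M)$ has monoid presentation $\langle Y:Q\rangle$ via $\psi:Y^*\to\mathbb E(M)$, where $y\psi\neq1$ for all $y\in Y$, and let $\{h_a:a\in\mathbb E(M)\}\subseteq Y^*$ be a set of words with $h_a\psi=a$ for all $a\in\mathbb E(M)$. Let the alphabets $\mathbf Y$ and $X_1$, the sets of relations $\mathbf Q$, $R_\leftrightarrow$, $R_1'$ and $R_\nabla$, and the homomorphism $\Theta:(\mathbf Y\cup X_1)^*\to\mathbb E(M\wr\mathcal T_n)$ be defined from these data as in the context. Then the idempotent-generated subsemigroup $\mathbb E(M\wr\mathcal T_n)=\langle E(M\wr\mathcal T_n)\rangle$ of $M\wr\mathcal T_n$ has monoid presentation $\langle\mathbf Y\cup X_1 : \mathbf Q\cup R_\leftrightarrow\cup R_1'\cup R_\nabla\rangle$ via $\Theta$.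
   Context: Maps are written on the right and composed from left to right. $\mathcal T_n$ is the monoid of all maps $\{1,\ldots,n\}\to\{1,\ldots,n\}$, with identity $1_n$. The wreath product $M\wr\mathcal T_n$ is the set $M^n\times\mathcal T_n$ with product $((a_1,\ldots,a_n),\alpha)((b_1,\ldots,b_n),\beta)=((a_1b_{1\alpha},\ldots,a_nb_{n\alpha}),\alpha\beta)$. For a semigroup $T$, $E(T)$ is its set of idempotents and $\mathbb E(T)=\langle E(T)\rangle$ is the subsemigroup generated by them. A monoid $T$ has monoid presentation $\langle X:R\rangle$ via $\phi:X^*\to T$ (where $X^*$ is the free monoid on $X$ and $R\subseteq X^*\times X^*$) if $\phi$ is a surjective monoid homomorphism whose kernel $\{(u,v):u\phi=v\phi\}$ is the congruence on $X^*$ generated by $R$. A relation $u=v$ stands for the pair $(u,v)$; a chain $u=v=w$ stands for $u=v$ and $v=w$. Elements of the wreath product: for distinct $i,j\in\{1,\ldots,n\}$, $\varepsilon_{ij}\in\mathcal T_n$ is the map with $j\varepsilon_{ij}=i$ and $k\varepsilon_{ij}=k$ for $k\neq j$; for $a\in M$, $\varepsilon_{ij;a}=(\mathbf a,\varepsilon_{ij})$ where $\mathbf a$ has $j$th coordinate $a$ and all other coordinates $1$. For $a\in M$ and $i\in\{1,\ldots,n\}$, $a_{(i)}=((1,\ldots,1,a,1,\ldots,1),1_n)$ with $a$ in position $i$. Alphabets: for each $i\in\{1,\ldots,n\}$, $Y_{(i)}=\{y_{(i)}:y\in Y\}$ is a copy of $Y$ (the copies being disjoint), and $\mathbf Y=Y_{(1)}\cup\cdots\cup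 Y_{(n)}$; $X_1=\{e_{ij;a}: i\neq j,\ a\in G\}$ (disjoint from $\mathbf Y$), and $e_{ij}$ denotes $e_{ij;1}$. For a word $w=y_1\cdots y_k\in Y^*$, $w_{(i)}=(y_1)_{(i)}\cdots(y_k)_{(i)}$ and $\overline w=w\psi\in\mathbb E(M)$. For $a\in\mathbb E(M)$, $h_{a;i}=(h_a)_{(i)}\in Y_{(i)}^*$. The homomorphism $\Theta$ is given by $y_{(i)}\Theta=(\overline y)_{(i)}$ and $e_{ij;a}\Theta=\varepsilon_{ij;a}$. Relations: $\mathbf Q=\{(u_{(i)},v_{(i)}):(u,v)\in Q,\ 1\le i\le n\}$ and $R_\leftrightarrow=\{(x_{(i)}y_{(j)},y_{(j)}x_{(i)}):x,y\in Y,\ i\neq j\}$. $R_1'$ consists of the following relations, where $a,b$ range over $G$ and $i,j,k,l$ over distinct elements of $\{1,\ldots,n\}$ (as many as occur in the relation): - $e_{ij;a}e_{ij;b}=e_{ij;a}=e_{ji;a^{-1}}e_{ij;a}$; - $e_{ij;1}e_{ji;a}e_{ij;b}=e_{ji;1}e_{ij;ab}$; - $e_{ij;a}e_{kl;b}=e_{kl;b}e_{ij;a}$; - $e_{ik;a}e_{jk;b}=e_{ik;a}$; - $e_{ij;1}e_{jk;a}e_{kj;1}=e_{ji;1}e_{ik;a}e_{ki;1}e_{ij;1}$; - $e_{ij;1}e_{ji;a}e_{ik;b}=e_{ji;1}e_{ik;b}e_{kj;a}e_{jk;1}$; - $e_{ij;b}e_{ik;ab}=e_{ik;ab}e_{ij;b}=e_{jk;a}e_{ij;b}$;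 - $e_{ki}e_{ij}e_{jk}=e_{ik}e_{kj}e_{ji}e_{ik}$; - $e_{ki}e_{ij}e_{jk}e_{kl}=e_{ik}e_{kl}e_{li}e_{ij}e_{jl}$ (monoid subscripts such as $ab$ are products in $G$). $R_\nabla$ consists of the following relations, for all $y\in Y$, $a,b\in G$, distinct $i,j\in\{1,\ldots,n\}$ and $k\in\{1,\ldots,n\}$: - $e_{ij;a}y_{(i)}=y_{(i)}h_{a\overline y;j}e_{ij;1}$; - $e_{ij;a}y_{(j)}=e_{ij;a}$; - $e_{ij;a}y_{(k)}=y_{(k)}e_{ij;a}$ if $k\notin\{i,j\}$; - $y_{(j)}e_{ij;a}=h_{\overline y a;j}e_{ij;1}$; - $y_{(i)}e_{ji;a}e_{ij;b}=h_{\overline y ab;i}e_{ij;b}$. (Since $\overline y\neq1$, we have $\overline y\in M\setminus G$, so $a\overline y$, $\overline y a$ and $\overline y ab$ lie in $M\setminus G\subseteq\mathbb E(M)$ and the words $h$ above are defined.) *)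

theory Defs
  imports "HOL-Algebra.Group" "HOL-Library.FuncSet"
begin

section \<open>Idempotent-generated subsemigroups\<close>

definition idempotents :: "('a, 'm) monoid_scheme \<Rightarrow> 'a set"
  where "idempotents T = {x \<in> carrier T. x \<otimes>\<^bsub>T\<^esub> x = x}"

inductive_set subsemigroup_gen :: "('a, 'm) monoid_scheme \<Rightarrow> 'a set \<Rightarrow> 'a set"
  for T :: "('a, 'm) monoid_scheme" and A :: "'a set" where
  gen: "x \<in> A \<Longrightarrow> x \<in> subsemigroup_gen T A"
| mult: "x \<in> subsemigroup_gen T A \<Longrightarrow> y \<in> subsemigroup_gen T A
    \<Longrightarrow> x \<otimes>\<^bsub>T\<^esub> y \<in> subsemigroup_gen T A"

text \<open>As the identity of a monoid is idempotent, the idempotent-generated subsemigroup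
  inherits the identity of the monoid.\<close>

definition idem_gen :: "('a, 'm) monoid_scheme \<Rightarrow> ('a, 'm) monoid_scheme"
  where "idem_gen T = T\<lparr>carrier := subsemigroup_gen T (idempotents T)\<rparr>"


section \<open>Monoid presentations\<close>

definition free_monoid :: "'x set \<Rightarrow> 'x list monoid"
  where "free_monoid X = \<lparr>carrier = lists X, mult = (@), one = []\<rparr>"

inductive_set word_congruence :: "'x set \<Rightarrow> ('x list \<times> 'x list) set \<Rightarrow> ('x list \<times> 'x list) set"
  for X :: "'x set" and R :: "('x list \<times> 'x list) set" where
  base: "(u, v) \<in> R \<Longrightarrow> (u, v) \<in> word_congruence X R"
| refl: "w \<in> lists X \<Longrightarrow> (w, w) \<in> word_congruence X R"
| sym: "(u, v) \<in> word_congruence X R \<Longrightarrow> (v, u) \<in> word_congruence X R"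
| trans: "(u, v) \<in> word_congruence X R \<Longrightarrow> (v, w) \<in> word_congruence X R
    \<Longrightarrow> (u, w) \<in> word_congruence X R"
| mult: "(u, v) \<in> word_congruence X R \<Longrightarrow> (u', v') \<in> word_congruence X R
    \<Longrightarrow> (u @ u', v @ v') \<in> word_congruence X R"

definition monoid_presentation ::
    "('a, 'm) monoid_scheme \<Rightarrow> 'x set \<Rightarrow> ('x list \<times> 'x list) set \<Rightarrow> ('x list \<Rightarrow> 'a) \<Rightarrow> bool"
  where "monoid_presentation T X R \<phi> \<longleftrightarrow>
    monoid T \<and>
    R \<subseteq> lists X \<times> lists X \<and>
    \<phi> \<in> hom (free_monoid X) T \<and> \<phi> [] = \<one>\<^bsub>T\<^esub> \<and>
    \<phi> ` lists X = carrier T \<and>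
    {(u, v). u \<in> lists X \<and> v \<in> lists X \<and> \<phi> u = \<phi> v} = word_congruence X R"

text \<open>The homomorphism from a free monoid extending a map on the letters.\<close>

definition word_hom :: "('a, 'm) monoid_scheme \<Rightarrow> ('x \<Rightarrow> 'a) \<Rightarrow> 'x list \<Rightarrow> 'a"
  where "word_hom T f w = foldr (\<lambda>x t. f x \<otimes>\<^bsub>T\<^esub> t) w \<one>\<^bsub>T\<^esub>"


section \<open>The wreath product of a monoid with a full transformation monoid\<close>

text \<open>Maps act on the right and are composed from left to right, so the product of
  \<open>\<alpha>\<close> and \<open>\<beta>\<close> sends \<open>i\<close> to \<open>\<beta> (\<alpha> i)\<close>. Maps on \<open>{1..n}\<close>, and likewise \<open>n\<close>-tuples, are
  represented by functions that are undefined outside \<open>{1..n}\<close>.\<close>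

definition full_transf :: "nat \<Rightarrow> (nat \<Rightarrow> nat) monoid"
  where "full_transf n =
    \<lparr>carrier = {1..n} \<rightarrow>\<^sub>E {1..n},
     mult = (\<lambda>\<alpha> \<beta>. \<lambda>i\<in>{1..n}. \<beta> (\<alpha> i)),
     one = (\<lambda>i\<in>{1..n}. i)\<rparr>"

definition wreath :: "('a, 'm) monoid_scheme \<Rightarrow> nat \<Rightarrow> ((nat \<Rightarrow> 'a) \<times> (nat \<Rightarrow> nat)) monoid"
  where "wreath M n =
    \<lparr>carrier = ({1..n} \<rightarrow>\<^sub>E carrier M) \<times> carrier (full_transf n),
     mult = (\<lambda>(a, \<alpha>) (b, \<beta>). (\<lambda>i\<in>{1..n}. a i \<otimes>\<^bsub>M\<^esub> b (\<alpha> i), \<alpha> \<otimes>\<^bsub>full_transf n\<^esub> \<beta>)),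
     one = (\<lambda>i\<in>{1..n}. \<one>\<^bsub>M\<^esub>, \<one>\<^bsub>full_transf n\<^esub>)\<rparr>"

definition coord_tuple :: "('a, 'm) monoid_scheme \<Rightarrow> nat \<Rightarrow> nat \<Rightarrow> 'a \<Rightarrow> nat \<Rightarrow> 'a"
  where "coord_tuple M n i a = (\<lambda>k\<in>{1..n}. if k = i then a else \<one>\<^bsub>M\<^esub>)"

text \<open>\<open>coord_elt M n i a\<close> is $a_{(i)}$, and \<open>eps_elt M n i j a\<close> is
  $\varepsilon_{ij;a}$, whose underlying map sends \<open>j\<close> to \<open>i\<close>.\<close>

definition coord_elt :: "('a, 'm) monoid_scheme \<Rightarrow> nat \<Rightarrow> nat \<Rightarrow> 'a \<Rightarrow> (nat \<Rightarrow> 'a) \<times> (nat \<Rightarrow> nat)"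
  where "coord_elt M n i a = (coord_tuple M n i a, \<one>\<^bsub>full_transf n\<^esub>)"

definition eps :: "nat \<Rightarrow> nat \<Rightarrow> nat \<Rightarrow> nat \<Rightarrow> nat"
  where "eps n i j = (\<lambda>k\<in>{1..n}. if k = j then i else k)"

definition eps_elt ::
    "('a, 'm) monoid_scheme \<Rightarrow> nat \<Rightarrow> nat \<Rightarrow> nat \<Rightarrow> 'a \<Rightarrow> (nat \<Rightarrow> 'a) \<times> (nat \<Rightarrow> nat)"
  where "eps_elt M n i j a = (coord_tuple M n j a, eps n i j)"


section \<open>The generators\<close>

text \<open>\<open>Yl i y\<close> is the letter $y_{(i)}$ and \<open>El i j a\<close> is the letter $e_{ij;a}$.\<close>

datatype ('y, 'a) letter = Yl nat 'y | El nat nat 'a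

definition Y_letters :: "nat \<Rightarrow> 'y set \<Rightarrow> ('y, 'a) letter set"
  where "Y_letters n Y = {Yl i y | i y. i \<in> {1..n} \<and> y \<in> Y}"

definition X1_letters :: "('a, 'm) monoid_scheme \<Rightarrow> nat \<Rightarrow> ('y, 'a) letter set"
  where "X1_letters M n = {El i j a | i j a. i \<in> {1..n} \<and> j \<in> {1..n} \<and> i \<noteq> j \<and> a \<in> Units M}"

definition copy_word :: "nat \<Rightarrow> 'y list \<Rightarrow> ('y, 'a) letter list"
  where "copy_word i w = map (Yl i) w"

primrec Theta_letter ::
    "('a, 'm) monoid_scheme \<Rightarrow> nat \<Rightarrow> ('y list \<Rightarrow> 'a) \<Rightarrow> ('y, 'a) letter \<Rightarrow>
      (nat \<Rightarrow> 'a) \<times> (nat \<Rightarrow> nat)"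
  where
  "Theta_letter M n \<psi> (Yl i y) = coord_elt M n i (\<psi> [y])"
| "Theta_letter M n \<psi> (El i j a) = eps_elt M n i j a"

definition Theta ::
    "('a, 'm) monoid_scheme \<Rightarrow> nat \<Rightarrow> ('y list \<Rightarrow> 'a) \<Rightarrow> ('y, 'a) letter list \<Rightarrow>
      (nat \<Rightarrow> 'a) \<times> (nat \<Rightarrow> nat)"
  where "Theta M n \<psi> = word_hom (idem_gen (wreath M n)) (Theta_letter M n \<psi>)"


section \<open>The relations\<close>

definition Q_rels ::
    "nat \<Rightarrow> ('y list \<times> 'y list) set \<Rightarrow> (('y, 'a) letter list \<times> ('y, 'a) letter list) set"
  where "Q_rels n Q = {(copy_word i u, copy_word i v) | i u v. i \<in> {1..n} \<and> (u, v) \<in> Q}"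

definition R_comm :: "nat \<Rightarrow> 'y set \<Rightarrow> (('y, 'a) letter list \<times> ('y, 'a) letter list) set"
  where "R_comm n Y = {([Yl i x, Yl j y], [Yl j y, Yl i x]) | i j x y.
    i \<in> {1..n} \<and> j \<in> {1..n} \<and> i \<noteq> j \<and> x \<in> Y \<and> y \<in> Y}"

definition distinct_indices :: "nat \<Rightarrow> nat list \<Rightarrow> bool"
  where "distinct_indices n is \<longleftrightarrow> distinct is \<and> set is \<subseteq> {1..n}"

text \<open>A chain of equations \<open>u = v = w\<close> contributes the pairs \<open>(u, v)\<close> and \<open>(v, w)\<close>.\<close>

inductive_set R1' ::
    "('a, 'm) monoid_scheme \<Rightarrow> nat \<Rightarrow> (('y, 'a) letter list \<times> ('y, 'a) letter list) set"
  for M :: "('a, 'm) monoid_scheme" (structure) and n :: nat where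
  "\<lbrakk>distinct_indices n [i, j]; a \<in> Units M; b \<in> Units M\<rbrakk> \<Longrightarrow>
    ([El i j a, El i j b], [El i j a]) \<in> R1' M n"
| "\<lbrakk>distinct_indices n [i, j]; a \<in> Units M\<rbrakk> \<Longrightarrow>
    ([El i j a], [El j i (inv a), El i j a]) \<in> R1' M n"
| "\<lbrakk>distinct_indices n [i, j]; a \<in> Units M; b \<in> Units M\<rbrakk> \<Longrightarrow>
    ([El i j \<one>, El j i a, El i j b], [El j i \<one>, El i j (a \<otimes> b)]) \<in> R1' M n"
| "\<lbrakk>distinct_indices n [i, j, k, l]; a \<in> Units M; b \<in> Units M\<rbrakk> \<Longrightarrow>
    ([El i j a, El k l b], [El k l b, El i j a]) \<in> R1' M n"
| "\<lbrakk>distinct_indices n [i, j, k]; a \<in> Units M; b \<in> Units M\<rbrakk> \<Longrightarrow>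
    ([El i k a, El j k b], [El i k a]) \<in> R1' M n"
| "\<lbrakk>distinct_indices n [i, j, k]; a \<in> Units M\<rbrakk> \<Longrightarrow>
    ([El i j \<one>, El j k a, El k j \<one>], [El j i \<one>, El i k a, El k i \<one>, El i j \<one>]) \<in> R1' M n"
| "\<lbrakk>distinct_indices n [i, j, k]; a \<in> Units M; b \<in> Units M\<rbrakk> \<Longrightarrow>
    ([El i j \<one>, El j i a, El i k b], [El j i \<one>, El i k b, El k j a, El j k \<one>]) \<in> R1' M n"
| "\<lbrakk>distinct_indices n [i, j, k]; a \<in> Units M; b \<in> Units M\<rbrakk> \<Longrightarrow>
    ([El i j b, El i k (a \<otimes> b)], [El i k (a \<otimes> b), El i j b]) \<in> R1' M n"
| "\<lbrakk>distinct_indices n [i, j, k]; a \<in> Units M; b \<in> Units M\<rbrakk> \<Longrightarrow>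
    ([El i k (a \<otimes> b), El i j b], [El j k a, El i j b]) \<in> R1' M n"
| "\<lbrakk>distinct_indices n [i, j, k]\<rbrakk> \<Longrightarrow>
    ([El k i \<one>, El i j \<one>, El j k \<one>], [El i k \<one>, El k j \<one>, El j i \<one>, El i k \<one>]) \<in> R1' M n"
| "\<lbrakk>distinct_indices n [i, j, k, l]\<rbrakk> \<Longrightarrow>
    ([El k i \<one>, El i j \<one>, El j k \<one>, El k l \<one>],
     [El i k \<one>, El k l \<one>, El l i \<one>, El i j \<one>, El j l \<one>]) \<in> R1' M n"

inductive_set R_nabla ::
    "('a, 'm) monoid_scheme \<Rightarrow> nat \<Rightarrow> 'y set \<Rightarrow> ('y list \<Rightarrow> 'a) \<Rightarrow> ('a \<Rightarrow> 'y list) \<Rightarrow>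
      (('y, 'a) letter list \<times> ('y, 'a) letter list) set"
  for M :: "('a, 'm) monoid_scheme" (structure) and n :: nat and Y :: "'y set"
    and \<psi> :: "'y list \<Rightarrow> 'a" and h :: "'a \<Rightarrow> 'y list" where
  "\<lbrakk>y \<in> Y; distinct_indices n [i, j]; a \<in> Units M\<rbrakk> \<Longrightarrow>
    ([El i j a, Yl i y], [Yl i y] @ copy_word j (h (a \<otimes> \<psi> [y])) @ [El i j \<one>])
      \<in> R_nabla M n Y \<psi> h"
| "\<lbrakk>y \<in> Y; distinct_indices n [i, j]; a \<in> Units M\<rbrakk> \<Longrightarrow>
    ([El i j a, Yl j y], [El i j a]) \<in> R_nabla M n Y \<psi> h"
| "\<lbrakk>y \<in> Y; distinct_indices n [i, j]; k \<in> {1..n}; k \<notin> {i, j}; a \<in> Units M\<rbrakk> \<Longrightarrow>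
    ([El i j a, Yl k y], [Yl k y, El i j a]) \<in> R_nabla M n Y \<psi> h"
| "\<lbrakk>y \<in> Y; distinct_indices n [i, j]; a \<in> Units M\<rbrakk> \<Longrightarrow>
    ([Yl j y, El i j a], copy_word j (h (\<psi> [y] \<otimes> a)) @ [El i j \<one>]) \<in> R_nabla M n Y \<psi> h"
| "\<lbrakk>y \<in> Y; distinct_indices n [i, j]; a \<in> Units M; b \<in> Units M\<rbrakk> \<Longrightarrow>
    ([Yl i y, El j i a, El i j b], copy_word i (h (\<psi> [y] \<otimes> a \<otimes> b)) @ [El i j b])
      \<in> R_nabla M n Y \<psi> h"

end

theory Submission imports Defs "HOL-Combinatorics.Permutations" begin

text \<open>
  Words are read as motions of labelled tokens: \<open>El i j a\<close> moves every token at \<open>j\<close> to \<open>i\<close> and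
  multiplies its label by \<open>a\<close>. For two words over \<open>X1\<close> with the same effect, merges can be
  absorbed on the left until both words act injectively on the tokens that are left. As every
  nonempty word leaves some position unoccupied, the remaining moves can be rewritten in terms
  of transpositions of tokens through a hole and of unit scalars produced by moving a token
  into a hole and back. These operations satisfy the defining relations of the wreath product
  of the group of units with the symmetric group, so they depend only on their effect on the
  occupied positions.

  In a general word, the letters from the copies of \<open>Y\<close> can be moved to the left. If the copy
  with index \<open>i\<close> occurs, then the unit label of token \<open>i\<close> can be absorbed into it. The label of
  each token is then either a unit, coming from \<open>X1\<close>, or a nonunit, coming from \<open>Y\<close>, and can be
  read off from the image of the word.\<close>

text \<open>A nonempty word over \<open>X1\<close> never acts injectively on the positions, so
  nontrivial permutations and unit scalars are not themselves effects of such words. They exist only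
  as operations on a state that already has a hole. Hence words are studied through the right action
  of letters on congruence classes, and \<open>sw\<close> and \<open>gm\<close> are functions on
  classes rather than words. The hole used inside such an operation must be irrelevant, and it has
  to be exchanged for another in the middle of a computation. The long relations of
  \<open>R1'\<close> do this: applied at a suitable hole, one of their letters empties a position
  that is already empty, hence acts trivially, and what is left is an identity of transpositions or
  scalars. Absorbing merges is a matter of left multiplication, which the right action does not see.
  A merge placed in front of a word is therefore transported through the word, letter by letter, to
  the letter at which the two tokens collide.\<close>

lemma subsemigroup_gen_carrier:
  assumes "monoid T" "x \<in> subsemigroup_gen T (idempotents T)"
  shows "x \<in> carrier T"
  using assms(2) by induction (auto simp: idempotents_def intro: monoid.m_closed[OF assms(1)])

lemma monoid_idem_gen:
  assumes "monoid T"
  shows "monoid (idem_gen T)"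
proof -
  interpret monoid T by fact
  have "\<one>\<^bsub>T\<^esub> \<in> subsemigroup_gen T (idempotents T)"
    by (rule subsemigroup_gen.gen) (simp add: idempotents_def)
  then show ?thesis
    using subsemigroup_gen_carrier[OF assms]
    by unfold_locales (auto simp: idem_gen_def m_assoc intro: subsemigroup_gen.mult)
qed

locale wreath_presentation = monoid M for M :: "('a, 'm) monoid_scheme" (structure) +
  fixes n :: nat
    and Y :: "'y set"
    and Q :: "('y list \<times> 'y list) set"
    and \<psi> :: "'y list \<Rightarrow> 'a"
    and h :: "'a \<Rightarrow> 'y list"
  assumes idem_carrier: "carrier (idem_gen M) = {\<one>} \<union> (carrier M - Units M)"
    and pres: "monoid_presentation (idem_gen M) Y Q \<psi>"
    and psi_letter: "\<And>y. y \<in> Y \<Longrightarrow> \<psi> [y] \<noteq> \<one>"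
    and h_props: "\<And>a. a \<in> carrier (idem_gen M) \<Longrightarrow> h a \<in> lists Y \<and> \<psi> (h a) = a"
begin

definition I :: "nat set" where "I = {1..n}"

abbreviation G :: "'a set" where "G \<equiv> Units M"

abbreviation X1 :: "('y, 'a) letter set" where "X1 \<equiv> X1_letters M n"

definition X :: "('y, 'a) letter set" where "X = Y_letters n Y \<union> X1_letters M n"

abbreviation R :: "(('y, 'a) letter list \<times> ('y, 'a) letter list) set"
  where "R \<equiv> Q_rels n Q \<union> R_comm n Y \<union> R1' M n \<union> R_nabla M n Y \<psi> h"

definition eqv :: "('y, 'a) letter list \<Rightarrow> ('y, 'a) letter list \<Rightarrow> bool" (infix "\<approx>" 50)
  where "u \<approx> v \<longleftrightarrow> (u, v) \<in> word_congruence X R"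

section \<open>The action of words on tokens\<close>

text \<open>A pair of a tuple and a map is viewed as a system of tokens, one starting at each
  position, where token \<open>p\<close> ends at the image of \<open>p\<close> with the \<open>p\<close>-th coordinate as its label.
  A letter moves tokens and multiplies their labels on the right.\<close>

primrec lpos :: "('y, 'a) letter \<Rightarrow> nat \<Rightarrow> nat" where
  "lpos (Yl i y) p = p"
| "lpos (El i j a) p = (if p = j then i else p)"

primrec llab :: "('y, 'a) letter \<Rightarrow> nat \<Rightarrow> 'a" where
  "llab (Yl i y) p = (if p = i then \<psi> [y] else \<one>)"
| "llab (El i j a) p = (if p = j then a else \<one>)"

primrec pos :: "('y, 'a) letter list \<Rightarrow> nat \<Rightarrow> nat" where
  "pos [] p = p"
| "pos (x # w) p = pos w (lpos x p)"

primrec lab :: "('y, 'a) letter list \<Rightarrow> nat \<Rightarrow> 'a" where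
  "lab [] p = \<one>"
| "lab (x # w) p = llab x p \<otimes> lab w (lpos x p)"

section \<open>Units, nonunits and the values of words over \<open>Y\<close>\<close>

lemma G_carrier [simp]: "a \<in> G \<Longrightarrow> a \<in> carrier M"
  by (rule Units_closed)

lemma psi_hom: "u \<in> lists Y \<Longrightarrow> v \<in> lists Y \<Longrightarrow> \<psi> (u @ v) = \<psi> u \<otimes> \<psi> v"
  using pres by (auto simp: monoid_presentation_def hom_def free_monoid_def idem_gen_def)

lemma psi_Nil [simp]: "\<psi> [] = \<one>"
  using pres by (auto simp: monoid_presentation_def idem_gen_def)

lemma psi_in: "u \<in> lists Y \<Longrightarrow> \<psi> u \<in> carrier (idem_gen M)"
  using pres by (auto simp: monoid_presentation_def)

lemma psi_carrier [simp]: "u \<in> lists Y \<Longrightarrow> \<psi> u \<in> carrier M"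
  using psi_in[of u] idem_carrier by auto

lemma psi_eq_iff: "u \<in> lists Y \<Longrightarrow> v \<in> lists Y \<Longrightarrow> \<psi> u = \<psi> v \<longleftrightarrow> (u, v) \<in> word_congruence Y Q"
  using pres unfolding monoid_presentation_def by blast

lemma Q_lists: "(u, v) \<in> Q \<Longrightarrow> u \<in> lists Y \<and> v \<in> lists Y"
  using pres unfolding monoid_presentation_def by blast

lemma Q_psi: "(u, v) \<in> Q \<Longrightarrow> \<psi> u = \<psi> v"
  using Q_lists[of u v] psi_eq_iff[of u v] word_congruence.base[of u v Q Y] by simp

lemma psi_nonunit_letter: "y \<in> Y \<Longrightarrow> \<psi> [y] \<in> carrier M - G"
  using psi_in[of "[y]"] psi_letter[of y] idem_carrier by auto

lemma nonunit_mult_right: "x \<in> carrier M - G \<Longrightarrow> a \<in> G \<Longrightarrow> x \<otimes> a \<in> carrier M - G"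
  by (metis DiffD1 DiffD2 DiffI Units_closed Units_inv_Units Units_m_closed Units_r_inv m_assoc m_closed r_one
      Units_inv_closed)

lemma nonunit_mult_left: "x \<in> carrier M - G \<Longrightarrow> a \<in> G \<Longrightarrow> a \<otimes> x \<in> carrier M - G"
  by (metis DiffD1 DiffD2 DiffI Units_closed Units_inv_Units Units_m_closed Units_l_inv m_assoc m_closed l_one
      Units_inv_closed)

lemma h_nonunit: "a \<in> carrier M - G \<Longrightarrow> h a \<in> lists Y" "a \<in> carrier M - G \<Longrightarrow> \<psi> (h a) = a"
  using h_props[of a] idem_carrier by auto

text \<open>A product \<open>x \<otimes> y = 1\<close> forces \<open>e = e \<otimes> x \<otimes> y = 1\<close> for any idempotent \<open>e\<close> with \<open>e \<otimes> x = x\<close>.\<close>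

lemma idem_gen_left_fix:
  assumes "x \<in> subsemigroup_gen M (idempotents M)" "x \<noteq> \<one>"
  shows "\<exists>e\<in>carrier M. e \<noteq> \<one> \<and> e \<otimes> x = x"
  using assms
proof (induction rule: subsemigroup_gen.induct)
  case (gen x)
  then show ?case by (auto simp: idempotents_def)
next
  case (mult x y)
  have "subsemigroup_gen M (idempotents M) \<subseteq> carrier M"
    using idem_carrier by (auto simp: idem_gen_def)
  then have xy: "x \<in> carrier M" "y \<in> carrier M" using mult.hyps by auto
  show ?case
  proof (cases "x = \<one>")
    case True
    then show ?thesis using mult xy by auto
  next
    case False
    then obtain e where "e \<in> carrier M" "e \<noteq> \<one>" "e \<otimes> x = x" using mult by blast
    then show ?thesis using xy by (metis m_assoc)
  qed
qed

text \<open>This separates the two sources of labels: a label is a nonunit as soon as one letter of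
  \<open>Y\<close> contributes to it. By the shape of the carrier of \<open>idem_gen M\<close> only
  the value 1 has to be excluded, and an element fixing the first letter from the left does
  this.\<close>

lemma psi_nonunit: "w \<in> lists Y \<Longrightarrow> w \<noteq> [] \<Longrightarrow> \<psi> w \<in> carrier M - G"
proof (cases w)
  case (Cons y v)
  assume w: "w \<in> lists Y"
  then have yv: "y \<in> Y" "v \<in> lists Y" using Cons by auto
  have eq: "\<psi> w = \<psi> [y] \<otimes> \<psi> v" using psi_hom[of "[y]" v] yv Cons by simp
  obtain e where e: "e \<in> carrier M" "e \<noteq> \<one>" "e \<otimes> \<psi> [y] = \<psi> [y]"
    using idem_gen_left_fix[of "\<psi> [y]"] psi_in[of "[y]"] psi_letter yv by (auto simp: idem_gen_def)
  have "\<psi> w \<noteq> \<one>"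
  proof
    assume "\<psi> w = \<one>"
    then have "e = e \<otimes> (\<psi> [y] \<otimes> \<psi> v)" using e eq by simp
    also have "\<dots> = \<psi> [y] \<otimes> \<psi> v" using e yv by (metis lists.simps m_assoc psi_carrier)
    finally show False using \<open>\<psi> w = \<one>\<close> eq e by simp
  qed
  then show ?thesis using psi_in[OF w] idem_carrier by auto
qed simp

section \<open>Letters, their effects and soundness of the relations\<close>

lemma El_in_X1 [simp]: "El i j a \<in> X1 \<longleftrightarrow> i \<in> I \<and> j \<in> I \<and> i \<noteq> j \<and> a \<in> G"
  by (auto simp: X1_letters_def I_def)

lemma Yl_in_X1 [simp]: "Yl i y \<notin> X1"
  by (auto simp: X1_letters_def)

lemma Yl_in_Y [simp]: "Yl i y \<in> Y_letters n Y \<longleftrightarrow> i \<in> I \<and> y \<in> Y"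
  by (auto simp: Y_letters_def I_def)

lemma El_in_Y [simp]: "El i j a \<notin> Y_letters n Y"
  by (auto simp: Y_letters_def)

lemma El_in_X [simp]: "El i j a \<in> X \<longleftrightarrow> i \<in> I \<and> j \<in> I \<and> i \<noteq> j \<and> a \<in> G"
  by (simp add: X_def)

lemma Yl_in_X [simp]: "Yl i y \<in> X \<longleftrightarrow> i \<in> I \<and> y \<in> Y"
  by (simp add: X_def)

lemma lpos_I: "x \<in> X \<Longrightarrow> p \<in> I \<Longrightarrow> lpos x p \<in> I"
  by (cases x) auto

lemma pos_I: "w \<in> lists X \<Longrightarrow> p \<in> I \<Longrightarrow> pos w p \<in> I"
  by (induction w arbitrary: p) (auto simp: lpos_I)

lemma llab_carrier [simp]: "x \<in> X \<Longrightarrow> llab x p \<in> carrier M"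
  by (cases x) auto

lemma lab_carrier [simp]: "w \<in> lists X \<Longrightarrow> lab w p \<in> carrier M"
  by (induction w arbitrary: p) auto

lemma X1_X: "w \<in> lists X1 \<Longrightarrow> w \<in> lists X"
  by (auto simp: X_def)

lemma lab_unit [simp]: "w \<in> lists X1 \<Longrightarrow> lab w p \<in> G"
proof (induction w arbitrary: p)
  case (Cons x w)
  then show ?case by (cases x) auto
qed auto

lemma pos_append [simp]: "pos (u @ v) p = pos v (pos u p)"
  by (induction u arbitrary: p) auto

lemma lab_append [simp]: "u \<in> lists X \<Longrightarrow> v \<in> lists X \<Longrightarrow> lab (u @ v) p = lab u p \<otimes> lab v (pos u p)"
  by (induction u arbitrary: p) (auto simp: m_assoc)

lemma pos_copy [simp]: "pos (copy_word i w) p = p"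
  by (induction w) (auto simp: copy_word_def)

lemma lab_copy [simp]: "w \<in> lists Y \<Longrightarrow> lab (copy_word i w) p = (if p = i then \<psi> w else \<one>)"
proof (induction w)
  case (Cons y w)
  then show ?case using psi_hom[of "[y]" w] by (auto simp: copy_word_def)
qed (auto simp: copy_word_def)

lemma copy_in_Y: "i \<in> I \<Longrightarrow> w \<in> lists Y \<Longrightarrow> copy_word i w \<in> lists (Y_letters n Y)"
  by (induction w) (auto simp: copy_word_def)

lemma copy_in_X: "i \<in> I \<Longrightarrow> w \<in> lists Y \<Longrightarrow> copy_word i w \<in> lists X"
  using copy_in_Y by (auto simp: X_def)

lemma distinct_indices_iff: "distinct_indices n is \<longleftrightarrow> distinct is \<and> set is \<subseteq> I"
  by (auto simp: distinct_indices_def I_def)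

lemma R1'_sound:
  assumes "(u, v) \<in> R1' M n"
  shows "u \<in> lists X1 \<and> v \<in> lists X1 \<and> (\<forall>p. pos u p = pos v p \<and> lab u p = lab v p)"
  using assms by cases (simp_all add: distinct_indices_iff m_assoc m_assoc[symmetric, of "inv _"])

lemma R_nabla_sound:
  assumes "(u, v) \<in> R_nabla M n Y \<psi> h"
  shows "u \<in> lists X \<and> v \<in> lists X \<and> (\<forall>p. pos u p = pos v p \<and> lab u p = lab v p)"
  using assms
proof cases
  case (1 y i j a)
  have w: "a \<otimes> \<psi> [y] \<in> carrier M - G" using 1 nonunit_mult_left psi_nonunit_letter by blast
  note w = h_nonunit[OF w]
  have "copy_word j (h (a \<otimes> \<psi> [y])) \<in> lists X" using 1 w copy_in_X by (auto simp: distinct_indices_iff)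
  then show ?thesis using 1 w by (auto simp: distinct_indices_iff)
next
  case (4 y i j a)
  have w: "\<psi> [y] \<otimes> a \<in> carrier M - G" using 4 nonunit_mult_right psi_nonunit_letter by blast
  note w = h_nonunit[OF w]
  have "copy_word j (h (\<psi> [y] \<otimes> a)) \<in> lists X" using 4 w copy_in_X by (auto simp: distinct_indices_iff)
  then show ?thesis using 4 w by (auto simp: distinct_indices_iff)
next
  case (5 y i j a b)
  have w: "\<psi> [y] \<otimes> a \<otimes> b \<in> carrier M - G" using 5 nonunit_mult_right psi_nonunit_letter by blast
  note w = h_nonunit[OF w]
  have "copy_word i (h (\<psi> [y] \<otimes> a \<otimes> b)) \<in> lists X" using 5 w copy_in_X by (auto simp: distinct_indices_iff)
  then show ?thesis using 5 w by (auto simp: distinct_indices_iff m_assoc)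
qed (auto simp: distinct_indices_iff I_def)

lemma R_sound:
  assumes "(u, v) \<in> R"
  shows "u \<in> lists X \<and> v \<in> lists X \<and> (\<forall>p. pos u p = pos v p \<and> lab u p = lab v p)"
proof -
  consider "(u, v) \<in> Q_rels n Q" | "(u, v) \<in> R_comm n Y" | "(u, v) \<in> R1' M n"
    | "(u, v) \<in> R_nabla M n Y \<psi> h" using assms by blast
  then show ?thesis
  proof cases
    case 1
    then obtain i u' v' where "i \<in> I" "(u', v') \<in> Q" "u = copy_word i u'" "v = copy_word i v'"
      by (auto simp: Q_rels_def I_def)
    then show ?thesis using Q_lists[of u' v'] Q_psi[of u' v'] copy_in_X by simp
  next
    case 2
    then show ?thesis by (auto simp: R_comm_def I_def)
  next
    case 3
    then show ?thesis using R1'_sound X1_X by blast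
  next
    case 4
    then show ?thesis by (rule R_nabla_sound)
  qed
qed

lemma eqv_sound: "u \<approx> v \<Longrightarrow> u \<in> lists X \<and> v \<in> lists X \<and> (\<forall>p. pos u p = pos v p \<and> lab u p = lab v p)"
  unfolding eqv_def
proof (induction rule: word_congruence.induct)
  case (base u v)
  then show ?case by (rule R_sound)
next
  case (mult u v u' v')
  then show ?case by (metis append_in_lists_conv lab_append pos_append)
qed auto

lemma eqv_lists: "u \<approx> v \<Longrightarrow> u \<in> lists X" "u \<approx> v \<Longrightarrow> v \<in> lists X"
  and eqv_pos: "u \<approx> v \<Longrightarrow> pos u p = pos v p"
  and eqv_lab: "u \<approx> v \<Longrightarrow> lab u p = lab v p"
  using eqv_sound by blast+

lemma eqv_refl: "u \<in> lists X \<Longrightarrow> u \<approx> u"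
  by (simp add: eqv_def word_congruence.refl)

lemma eqv_sym: "u \<approx> v \<Longrightarrow> v \<approx> u"
  by (simp add: eqv_def word_congruence.sym)

lemma eqv_trans [trans]: "u \<approx> v \<Longrightarrow> v \<approx> w \<Longrightarrow> u \<approx> w"
  unfolding eqv_def by (rule word_congruence.trans)

lemma eqv_append: "u \<approx> v \<Longrightarrow> u' \<approx> v' \<Longrightarrow> u @ u' \<approx> v @ v'"
  unfolding eqv_def by (rule word_congruence.mult)

lemma R1'_eqv: "(u, v) \<in> R1' M n \<Longrightarrow> u \<approx> v"
  by (simp add: eqv_def word_congruence.base)

lemma R_nabla_eqv: "(u, v) \<in> R_nabla M n Y \<psi> h \<Longrightarrow> u \<approx> v"
  by (simp add: eqv_def word_congruence.base)

section \<open>Congruence classes and their right action\<close>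

definition cls :: "('y, 'a) letter list \<Rightarrow> ('y, 'a) letter list set"
  where "cls u = {v. u \<approx> v}"

text \<open>Acting on classes turns every defining relation into an equation between sets, so that
  later computations are plain rewriting instead of congruence reasoning.\<close>

definition act :: "('y, 'a) letter list set \<Rightarrow> ('y, 'a) letter \<Rightarrow> ('y, 'a) letter list set"
    (infixl "\<star>" 65)
  where "U \<star> x = {v. \<exists>u\<in>U. u @ [x] \<approx> v}"

text \<open>The empty word is excluded because its class has no hole; \<open>C0\<close> readmits it
  for statements that need none.\<close>

definition C :: "('y, 'a) letter list set set"
  where "C = cls ` (lists X1 - {[]})"

definition C0 :: "('y, 'a) letter list set set"
  where "C0 = cls ` lists X1"

text \<open>Any representative may be chosen, since congruent words have equal effects.\<close>

definition posc :: "('y, 'a) letter list set \<Rightarrow> nat \<Rightarrow> nat"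
  where "posc U = pos (SOME u. u \<in> U)"

definition labc :: "('y, 'a) letter list set \<Rightarrow> nat \<Rightarrow> 'a"
  where "labc U = lab (SOME u. u \<in> U)"

definition free :: "nat \<Rightarrow> ('y, 'a) letter list set \<Rightarrow> bool"
  where "free k U \<longleftrightarrow> k \<notin> posc U ` I"

lemma cls_eq_iff: "u \<in> lists X \<Longrightarrow> v \<in> lists X \<Longrightarrow> cls u = cls v \<longleftrightarrow> u \<approx> v"
  unfolding cls_def using eqv_refl eqv_sym eqv_trans by blast

lemma cls_eqI: "u \<approx> v \<Longrightarrow> cls u = cls v"
  using cls_eq_iff eqv_lists by blast

lemma cls_act:
  assumes "u \<in> lists X" "x \<in> X"
  shows "cls u \<star> x = cls (u @ [x])"
proof -
  have "v @ [x] \<approx> u @ [x]" if "u \<approx> v" for v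
    using eqv_append[OF eqv_sym[OF that] eqv_refl[of "[x]"]] assms by simp
  then show ?thesis
    unfolding cls_def act_def using eqv_refl[OF assms(1)] eqv_trans eqv_sym by blast
qed

lemma some_cls: "u \<in> lists X \<Longrightarrow> u \<approx> (SOME v. v \<in> cls u)"
  using someI[of "\<lambda>v. v \<in> cls u" u] eqv_refl unfolding cls_def by simp

lemma posc_cls: "u \<in> lists X \<Longrightarrow> posc (cls u) = pos u"
  unfolding posc_def using some_cls eqv_pos by fastforce

lemma labc_cls: "u \<in> lists X \<Longrightarrow> labc (cls u) = lab u"
  unfolding labc_def using some_cls eqv_lab by fastforce

lemma C_cases [consumes 1, case_names cls]:
  assumes "U \<in> C" obtains u where "U = cls u" "u \<in> lists X1" "u \<noteq> []" "u \<in> lists X"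
  using assms X1_X unfolding C_def by blast

lemma C0_cases [consumes 1, case_names cls]:
  assumes "U \<in> C0" obtains u where "U = cls u" "u \<in> lists X1" "u \<in> lists X"
  using assms X1_X unfolding C0_def by blast

lemma C_C0 [simp]: "U \<in> C \<Longrightarrow> U \<in> C0"
  unfolding C_def C0_def by blast

lemma cls_C0: "u \<in> lists X1 \<Longrightarrow> cls u \<in> C0"
  unfolding C0_def by blast

lemma cls_C: "u \<in> lists X1 \<Longrightarrow> u \<noteq> [] \<Longrightarrow> cls u \<in> C"
  unfolding C_def by blast

lemma act_C [simp]: "U \<in> C0 \<Longrightarrow> i \<in> I \<Longrightarrow> j \<in> I \<Longrightarrow> i \<noteq> j \<Longrightarrow> a \<in> G \<Longrightarrow> U \<star> El i j a \<in> C"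
  by (elim C0_cases) (auto simp: cls_act intro!: cls_C)

lemma posc_act [simp]: "U \<in> C0 \<Longrightarrow> i \<in> I \<Longrightarrow> j \<in> I \<Longrightarrow> i \<noteq> j \<Longrightarrow> a \<in> G \<Longrightarrow>
    posc (U \<star> El i j a) p = (if posc U p = j then i else posc U p)"
  by (elim C0_cases) (auto simp: cls_act posc_cls)

lemma labc_act [simp]: "U \<in> C0 \<Longrightarrow> i \<in> I \<Longrightarrow> j \<in> I \<Longrightarrow> i \<noteq> j \<Longrightarrow> a \<in> G \<Longrightarrow>
    labc (U \<star> El i j a) p = labc U p \<otimes> (if posc U p = j then a else \<one>)"
  by (elim C0_cases) (auto simp: cls_act posc_cls labc_cls)

lemma labc_unit [simp]: "U \<in> C0 \<Longrightarrow> labc U p \<in> G"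
  by (elim C0_cases) (simp add: labc_cls)

lemma posc_I: "U \<in> C0 \<Longrightarrow> p \<in> I \<Longrightarrow> posc U p \<in> I"
  by (elim C0_cases) (simp add: posc_cls pos_I)

lemma free_act [simp]: "U \<in> C0 \<Longrightarrow> i \<in> I \<Longrightarrow> j \<in> I \<Longrightarrow> i \<noteq> j \<Longrightarrow> a \<in> G \<Longrightarrow>
    free k (U \<star> El i j a) \<longleftrightarrow> k = j \<or> (if k = i then free i U \<and> free j U else free k U)"
  unfolding free_def by (auto simp: image_iff)

lemma R1'_act:
  assumes "U \<in> C0" "(u, v) \<in> R1' M n"
  shows "foldl (\<star>) U u = foldl (\<star>) U v"
proof -
  have fold: "foldl (\<star>) (cls w) x = cls (w @ x)" if "w \<in> lists X" "x \<in> lists X" for w x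
    using that by (induction x arbitrary: w) (auto simp: cls_act)
  obtain w where w: "U = cls w" "w \<in> lists X" using assms(1) by (elim C0_cases)
  have e: "u \<approx> v" using assms(2) by (rule R1'_eqv)
  show ?thesis
    unfolding w(1) fold[OF w(2) eqv_lists(1)[OF e]] fold[OF w(2) eqv_lists(2)[OF e]]
    by (intro cls_eqI eqv_append eqv_refl w e)
qed

section \<open>The relations of \<open>R1'\<close> as equations of the action\<close>

context
  fixes U i j
  assumes U: "U \<in> C0" and ij: "i \<in> I" "j \<in> I" "i \<noteq> j"
begin

lemma rel1: "a \<in> G \<Longrightarrow> b \<in> G \<Longrightarrow> U \<star> El i j a \<star> El i j b = U \<star> El i j a"
  using R1'_act[OF U R1'.intros(1), of i j a b] ij by (simp add: distinct_indices_iff)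

lemma rel2: "a \<in> G \<Longrightarrow> U \<star> El j i (inv a) \<star> El i j a = U \<star> El i j a"
  using R1'_act[OF U R1'.intros(2), of i j a] ij by (simp add: distinct_indices_iff)

lemma rel3: "a \<in> G \<Longrightarrow> b \<in> G \<Longrightarrow>
    U \<star> El i j \<one> \<star> El j i a \<star> El i j b = U \<star> El j i \<one> \<star> El i j (a \<otimes> b)"
  using R1'_act[OF U R1'.intros(3), of i j a b] ij by (simp add: distinct_indices_iff)

lemma rel4: "k \<in> I \<Longrightarrow> l \<in> I \<Longrightarrow> k \<noteq> l \<Longrightarrow> k \<noteq> i \<Longrightarrow> k \<noteq> j \<Longrightarrow> l \<noteq> i \<Longrightarrow> l \<noteq> j \<Longrightarrow> a \<in> G \<Longrightarrow> b \<in> G \<Longrightarrow>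
    U \<star> El i j a \<star> El k l b = U \<star> El k l b \<star> El i j a"
  using R1'_act[OF U R1'.intros(4), of i j k l a b] ij by (simp add: distinct_indices_iff)

lemma rel5: "k \<in> I \<Longrightarrow> k \<noteq> i \<Longrightarrow> k \<noteq> j \<Longrightarrow> a \<in> G \<Longrightarrow> b \<in> G \<Longrightarrow>
    U \<star> El i k a \<star> El j k b = U \<star> El i k a"
  using R1'_act[OF U R1'.intros(5), of i j k a b] ij by (simp add: distinct_indices_iff)

lemma rel7: "k \<in> I \<Longrightarrow> k \<noteq> i \<Longrightarrow> k \<noteq> j \<Longrightarrow> a \<in> G \<Longrightarrow> b \<in> G \<Longrightarrow>
    U \<star> El i j \<one> \<star> El j i a \<star> El i k b = U \<star> El j i \<one> \<star> El i k b \<star> El k j a \<star> El j k \<one>"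
  using R1'_act[OF U R1'.intros(7), of i j k a b] ij by (simp add: distinct_indices_iff)

lemma rel8:
  assumes "k \<in> I" "k \<noteq> i" "k \<noteq> j" "a \<in> G" "b \<in> G"
  shows "U \<star> El i j a \<star> El i k b = U \<star> El i k b \<star> El i j a"
  \<comment> \<open>Arbitrary units fit the pattern of the relation, because \<open>b\<close> is the
    product of \<open>b \<otimes> inv a\<close> and \<open>a\<close>.\<close>
  using R1'_act[OF U R1'.intros(8), of i j k "b \<otimes> inv a" a] ij assms by (simp add: distinct_indices_iff m_assoc)

lemma rel9: "k \<in> I \<Longrightarrow> k \<noteq> i \<Longrightarrow> k \<noteq> j \<Longrightarrow> a \<in> G \<Longrightarrow> b \<in> G \<Longrightarrow>
    U \<star> El j k a \<star> El i j b = U \<star> El i k (a \<otimes> b) \<star> El i j b"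
  using R1'_act[OF U R1'.intros(9), of i j k a b] ij by (simp add: distinct_indices_iff)

lemma rel10: "k \<in> I \<Longrightarrow> k \<noteq> i \<Longrightarrow> k \<noteq> j \<Longrightarrow>
    U \<star> El k i \<one> \<star> El i j \<one> \<star> El j k \<one> = U \<star> El i k \<one> \<star> El k j \<one> \<star> El j i \<one> \<star> El i k \<one>"
  using R1'_act[OF U R1'.intros(10), of i j k] ij by (simp add: distinct_indices_iff)

lemma rel11: "k \<in> I \<Longrightarrow> l \<in> I \<Longrightarrow> k \<noteq> l \<Longrightarrow> k \<noteq> i \<Longrightarrow> k \<noteq> j \<Longrightarrow> l \<noteq> i \<Longrightarrow> l \<noteq> j \<Longrightarrow>
    U \<star> El k i \<one> \<star> El i j \<one> \<star> El j k \<one> \<star> El k l \<one> =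
    U \<star> El i k \<one> \<star> El k l \<one> \<star> El l i \<one> \<star> El i j \<one> \<star> El j l \<one>"
  using R1'_act[OF U R1'.intros(11), of i j k l] ij by (simp add: distinct_indices_iff)

end

section \<open>Holes and the absorption of merges\<close>

lemma finite_I [simp]: "finite I" by (simp add: I_def)

text \<open>The last letter vacates its second index, and no later letter refills it.\<close>

lemma pos_not_surj:
  "u \<in> lists X1 \<Longrightarrow> u \<noteq> [] \<Longrightarrow> \<exists>k\<in>I. k \<notin> pos u ` I"
proof (induction u rule: rev_induct)
  case (snoc x u)
  then obtain i j a where x: "x = El i j a" "i \<in> I" "j \<in> I" "i \<noteq> j" by (cases x) auto
  then show ?case by (intro bexI[of _ j]) auto
qed simp

lemma free_ex:
  assumes U: "U \<in> C" obtains k where "k \<in> I" "free k U"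
proof -
  obtain u where u: "U = cls u" "u \<in> lists X1" "u \<noteq> []" "u \<in> lists X"
    using U by (elim C_cases)
  then show ?thesis using pos_not_surj[of u] that by (auto simp: free_def posc_cls)
qed

text \<open>A move out of an empty position is inert. The induction looks at the last letter
  \<open>El k l b\<close> and either absorbs the new letter into it or commutes the new letter past
  it to reach the hypothesis; the indices are quantified inside because the hypothesis is also used
  for other moves.\<close>

lemma free_act_same:
  assumes "U \<in> C" "i \<in> I" "j \<in> I" "i \<noteq> j" "a \<in> G" "free j U"
  shows "U \<star> El i j a = U"
proof -
  have "\<forall>i j a. i \<in> I \<longrightarrow> j \<in> I \<longrightarrow> i \<noteq> j \<longrightarrow> a \<in> G \<longrightarrow> free j (cls u) \<longrightarrow> cls u \<star> El i j a = cls u"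
    if "u \<in> lists X1" "u \<noteq> []" for u
    using that
  proof (induction u rule: rev_induct)
    case (snoc x u)
    obtain k l b where x: "x = El k l b" "k \<in> I" "l \<in> I" "k \<noteq> l" "b \<in> G"
      using snoc by (cases x) auto
    define W where "W = cls u"
    show ?case
    proof (intro allI impI)
      fix i j a
      assume ij: "i \<in> I" "j \<in> I" "i \<noteq> j" "a \<in> G" "free j (cls (u @ [x]))"
      show "cls (u @ [x]) \<star> El i j a = cls (u @ [x])"
      proof (cases "u = []")
        case True
        have "j \<notin> (\<lambda>p. if p = l then k else p) ` I"
          using ij True x by (simp add: free_def posc_cls image_iff)
        then have "l = j" using ij x by (auto simp: image_iff)
        moreover have "[El k j b] @ [El i j a] \<approx> [El k j b]"
          using R1'.intros(1)[of n k j b M a] R1'.intros(5)[of n k i j b M a] ij x \<open>l = j\<close> R1'_eqv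
          by (cases "i = k") (auto simp: distinct_indices_iff)
        ultimately show ?thesis using True x ij cls_eqI by (simp add: cls_act)
      next
        case False
        then have W: "W \<in> C" using snoc cls_C by (auto simp: W_def)
        have e: "cls (u @ [x]) = W \<star> El k l b" using snoc.prems x X1_X[of u] by (simp add: W_def cls_act)
        have IH: "W \<star> El i j a = W" if "i \<in> I" "j \<in> I" "i \<noteq> j" "a \<in> G" "free j W" for i j a
          using snoc.IH snoc.prems False that by (simp add: W_def)
        note f = ij(5)[unfolded e]
        show ?thesis
        proof (cases "l = j")
          case True
          then show ?thesis unfolding e using ij x W rel1 rel5 by (cases "i = k") auto
        next
          case lj: False
          have fj: "free j W" using f W x ij lj by (auto split: if_splits)
          show ?thesis
          proof (cases "j = k")
            case True
            then have "free l W" using f W x ij lj by auto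
            then show ?thesis unfolding e using IH x fj ij by simp
          next
            case jk: False
            consider "i = k" | "i = l" | "i \<noteq> k" "i \<noteq> l" by blast
            then show ?thesis
            proof cases
              case 1
              then show ?thesis unfolding e using rel8[of W k l j b a] IH[of k j a] W x ij lj jk fj by simp
            next
              case 2
              \<comment> \<open>Here the new letter moves \<open>j\<close> to the just vacated
                \<open>l\<close>, so it does not commute with the last one. An inert
                \<open>El k j \<one>\<close> is inserted, brought next to the new letter, made to
                absorb it by \<open>rel5\<close>, and removed again.\<close>
              have "W \<star> El k l b \<star> El l j a = W \<star> El k j \<one> \<star> El k l b \<star> El l j a"
                using IH x ij jk fj by simp
              also have "\<dots> = W \<star> El k l b \<star> El k j \<one> \<star> El l j a"
                using rel8[of W k l j b \<one>] W x ij lj jk by simp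
              also have "\<dots> = W \<star> El k l b \<star> El k j \<one>"
                using rel5[of "W \<star> El k l b" k l j] W x ij lj jk by simp
              also have "\<dots> = W \<star> El k j \<one> \<star> El k l b"
                using rel8[of W k l j b \<one>] W x ij lj jk by simp
              also have "\<dots> = W \<star> El k l b"
                using IH x ij jk fj by simp
              finally show ?thesis unfolding e using 2 by simp
            next
              case 3
              then have "W \<star> El k l b \<star> El i j a = W \<star> El i j a \<star> El k l b"
                using x ij(1-4) lj jk by (intro rel4 C_C0 W) auto
              also have "\<dots> = W \<star> El k l b"
                using IH[OF ij(1-4) fj] by simp
              finally show ?thesis unfolding e .
            qed
          qed
        qed
      qed
    qed
  qed simp
  then show ?thesis using assms by (elim C_cases) blast
qed

text \<open>The hypothesis on \<open>b\<close> and \<open>b'\<close> says that a token at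
  \<open>l'\<close> reaches \<open>k\<close> with the same label whether it is merged into
  \<open>k'\<close> before \<open>El r s c\<close> or into \<open>k\<close> after it. The earlier
  merge is then redundant. This is the single step of \<open>merge_transport\<close>.\<close>

lemma two_letters:
  assumes U: "U \<in> C0"
    and I: "r \<in> I" "s \<in> I" "r \<noteq> s" "k \<in> I" "l \<in> I" "k \<noteq> l" "k' \<in> I" "l' \<in> I" "k' \<noteq> l'"
    and G: "b \<in> G" "b' \<in> G" "c \<in> G"
    and k: "k = (if k' = s then r else k')"
    and l: "l = (if l' = s then r else l')"
    and b: "(if l' = s then c else \<one>) \<otimes> b = b' \<otimes> (if k' = s then c else \<one>)"
  shows "U \<star> El k' l' b' \<star> El r s c \<star> El k l b = U \<star> El r s c \<star> El k l b"
proof -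
  consider (s) "k' \<noteq> s" "l' \<noteq> s" | (k) "k' = s" | (l) "l' = s" by blast
  then show ?thesis
  proof cases
    case s
    then have kl: "k' = k" "l' = l" "b' = b" using k l b G by auto
    have "V \<star> El r s c \<star> El k l b = V \<star> El k l b \<star> El r s c" if "V \<in> C0" "r \<noteq> l" for V
      using rel4[of V r s k l c b] rel8[of V k l s b c] that I G kl s by (cases "r = k") auto
    then have ?thesis if "r \<noteq> l" using rel1[of U k l b b] U I G kl that by simp
    moreover have ?thesis if "r = l"
    proof -
      have *: "V \<star> El r s c \<star> El k l b = V \<star> El k s (c \<otimes> b) \<star> El k l b" if "V \<in> C0" for V
        using rel9[of V k r s c b] that I G kl s \<open>r = l\<close> by simp
      have "U \<star> El k l b \<star> El k s (c \<otimes> b) \<star> El k l b = U \<star> El k s (c \<otimes> b) \<star> El k l b \<star> El k l b"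
        using rel8[of U k l s b "c \<otimes> b"] U I G kl s by simp
      then show ?thesis using * rel1[of _ k l b b] U I G kl s by simp
    qed
    ultimately show ?thesis by blast
  next
    case k
    then have kl: "k = r" "l' = l" "l \<noteq> s" "b = b' \<otimes> c" using assms by auto
    have "U \<star> El s l b' \<star> El r s c \<star> El r l b = U \<star> El r l b \<star> El r s c \<star> El r l b"
      using rel9[of U r s l b' c] U I G kl by simp
    also have "\<dots> = U \<star> El r s c \<star> El r l b \<star> El r l b"
      using rel8[of U r s l c b] U I G kl by simp
    also have "\<dots> = U \<star> El r s c \<star> El r l b"
      using rel1 U I G kl by simp
    finally show ?thesis using k kl by simp
  next
    case l
    then have kl: "l = r" "k' = k" "k \<noteq> s" "b' = c \<otimes> b" using assms by auto
    have *: "V \<star> El r s c \<star> El k r b = V \<star> El k s b' \<star> El k r b" if "V \<in> C0" for V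
      using rel9[of V k r s c b] that I G kl by simp
    then show ?thesis using rel1[of U k s b' b'] U I G kl l by simp
  qed
qed

lemma cls_Cons_cong:
  assumes "cls u = cls v" "u \<in> lists X" "v \<in> lists X" "x \<in> X"
  shows "cls (x # u) = cls (x # v)"
  using eqv_append[OF eqv_refl[of "[x]"], of u v] assms cls_eq_iff[of u v] by (intro cls_eqI) simp

text \<open>Both sides give token \<open>q\<close> the same label: merged first and carried along
  with \<open>p\<close> it gets \<open>a \<otimes> lab u p\<close>, merged last it gets
  \<open>lab u q \<otimes> b\<close>. The leading merge is pushed through \<open>u\<close> one
  letter at a time.\<close>

lemma merge_transport:
  assumes "u \<in> lists X1" "p \<in> I" "q \<in> I" "p \<noteq> q" "a \<in> G"
    and "pos u p = k" "pos u q = l" "k \<noteq> l" "b \<in> G" "lab u q \<otimes> b = a \<otimes> lab u p"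
  shows "cls (El p q a # u) \<star> El k l b = cls u \<star> El k l b"
  using assms
proof (induction u arbitrary: k l b rule: rev_induct)
  case Nil
  then show ?case using rel1[of "cls []" p q a a] cls_C0[of "[]"] by (simp add: cls_act)
next
  case (snoc x u)
  obtain r s c where x: "x = El r s c" "r \<in> I" "s \<in> I" "r \<noteq> s" "c \<in> G"
    using snoc.prems by (cases x) auto
  have u: "u \<in> lists X1" "u \<in> lists X" using snoc.prems X1_X[of u] by auto
  define W where "W = cls u"
  define V where "V = cls (El p q a # u)"
  have WV: "W \<in> C0" "V \<in> C0" using snoc.prems(2-5) u(1) by (simp_all add: W_def V_def cls_C0)
  define k' where "k' = pos u p"
  define l' where "l' = pos u q"
  have kl: "k = (if k' = s then r else k')" "l = (if l' = s then r else l')"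
    using snoc.prems(6,7) x by (auto simp: k'_def l'_def)
  have kl': "k' \<noteq> l'" using kl snoc.prems(8) by auto
  have I: "k' \<in> I" "l' \<in> I" "k \<in> I" "l \<in> I" using u(2) snoc.prems(2,3) kl x pos_I by (simp_all add: k'_def l'_def)
  \<comment> \<open>The unit that makes the merge just before the last letter compatible with
    \<open>a\<close>; solving for it is possible because \<open>lab u q\<close> is a unit.\<close>
  define b' where "b' = inv (lab u q) \<otimes> (a \<otimes> lab u p)"
  have G: "lab u q \<in> G" "lab u p \<in> G" "b' \<in> G" using u(1) snoc.prems(5) by (simp_all add: b'_def)
  have b': "lab u q \<otimes> b' = a \<otimes> lab u p"
    unfolding b'_def using G snoc.prems(5) by (simp add: m_assoc[symmetric])
  have "lab u q \<otimes> ((if l' = s then c else \<one>) \<otimes> b) = a \<otimes> lab u p \<otimes> (if k' = s then c else \<one>)"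
    using snoc.prems(10) x u(2) G snoc.prems(5,9) by (simp add: k'_def l'_def m_assoc)
  also have "\<dots> = lab u q \<otimes> (b' \<otimes> (if k' = s then c else \<one>))"
    using b' G x snoc.prems(5) by (simp add: m_assoc[symmetric])
  finally have b: "(if l' = s then c else \<one>) \<otimes> b = b' \<otimes> (if k' = s then c else \<one>)"
    using G x snoc.prems(9) by (simp add: Units_l_cancel)
  have *: "Z \<star> El k' l' b' \<star> El r s c \<star> El k l b = Z \<star> El r s c \<star> El k l b" if "Z \<in> C0" for Z
    by (rule two_letters[OF that x(2-4) I(3,4) snoc.prems(8) I(1,2) kl' snoc.prems(9) G(3) x(5) kl b])
  have "V \<star> El k' l' b' = W \<star> El k' l' b'"
    unfolding V_def W_def
    using kl' G b' by (intro snoc.IH u(1) snoc.prems(2-5)) (simp_all add: k'_def l'_def)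
  then have "V \<star> El r s c \<star> El k l b = W \<star> El r s c \<star> El k l b"
    using *[OF WV(1)] *[OF WV(2)] by simp
  moreover have "cls (El p q a # u @ [x]) = V \<star> El r s c" "cls (u @ [x]) = W \<star> El r s c"
    unfolding V_def W_def using u(2) x snoc.prems(2-5) by (simp_all add: cls_act)
  ultimately show ?case by simp
qed

lemma units_r_cancel: "x \<in> carrier M \<Longrightarrow> y \<in> carrier M \<Longrightarrow> a \<in> G \<Longrightarrow> x \<otimes> a = y \<otimes> a \<Longrightarrow> x = y"
  by (metis G_carrier Units_inv_closed Units_r_inv m_assoc r_one)

text \<open>Tokens \<open>p\<close> and \<open>q\<close> collide at some letter of \<open>u\<close>.
  If the collision precedes the last letter, the common unit at the end is cancelled; otherwise the
  last letter itself is the merge, and \<open>merge_transport\<close> applies to it.\<close>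

lemma merge_absorb:
  assumes "u \<in> lists X1" "p \<in> I" "q \<in> I" "p \<noteq> q" "a \<in> G"
    and "pos u p = pos u q" "lab u q = a \<otimes> lab u p"
  shows "cls (El p q a # u) = cls u"
  using assms
proof (induction u rule: rev_induct)
  case (snoc x u)
  obtain k l b where x: "x = El k l b" "k \<in> I" "l \<in> I" "k \<noteq> l" "b \<in> G"
    using snoc.prems by (cases x) auto
  have u: "u \<in> lists X1" "u \<in> lists X" using snoc.prems X1_X[of u] by auto
  have G: "lab u q \<in> G" "lab u p \<in> G" using u by auto
  have act: "cls (El p' q' a' # u @ [x]) = cls (El p' q' a' # u) \<star> El k l b"
    if "p' \<in> I" "q' \<in> I" "p' \<noteq> q'" "a' \<in> G" for p' q' a'
    using u(2) x that by (simp add: cls_act)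
  have act0: "cls (u @ [x]) = cls u \<star> El k l b"
    using u(2) x by (simp add: cls_act)
  consider (eq) "pos u p = pos u q" | (kl) "pos u p = k" "pos u q = l" | (lk) "pos u p = l" "pos u q = k"
    using snoc.prems x by (auto split: if_splits)
  then show ?case
  proof cases
    case eq
    define c where "c = (if pos u q = l then b else \<one>)"
    have c: "c \<in> G" using x by (simp add: c_def)
    have "lab u q \<otimes> c = (a \<otimes> lab u p) \<otimes> c"
      using eq snoc.prems(5,7) u x G by (auto simp: m_assoc c_def)
    then have "lab u q = a \<otimes> lab u p"
      using G snoc.prems(5) c units_r_cancel[of "lab u q" "a \<otimes> lab u p" c] by simp
    then have "cls (El p q a # u) = cls u"
      using eq by (intro snoc.IH u(1) snoc.prems(2-5))
    then show ?thesis using act act0 snoc.prems(2-5) by simp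
  next
    case kl
    then have "lab u q \<otimes> b = a \<otimes> lab u p" using snoc.prems(7) u(2) x G by simp
    then have "cls (El p q a # u) \<star> El k l b = cls u \<star> El k l b"
      using kl x by (intro merge_transport u(1) snoc.prems(2-5))
    then show ?thesis using act act0 snoc.prems(2-5) by simp
  next
    case lk
    have e: "lab u q = a \<otimes> (lab u p \<otimes> b)" using snoc.prems(7) u(2) x G lk by simp
    have "inv a \<otimes> lab u q = lab u p \<otimes> b" unfolding e using G x snoc.prems(5) by (simp add: m_assoc[symmetric])
    then have "cls (El q p (inv a) # u) \<star> El k l b = cls u \<star> El k l b"
      using lk x snoc.prems(2-5) by (intro merge_transport u(1)) auto
    then have *: "cls (El q p (inv a) # u @ [x]) = cls (u @ [x])"
      using act act0 snoc.prems(2-5) by simp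
    \<comment> \<open>The last letter merges in the opposite direction, so the reversed merge
      \<open>El q p (inv a)\<close> is the absorbable one. It is inserted, and relation
      \<open>e_{ij;a} = e_{ji;a^{-1}} e_{ij;a}\<close> lets it swallow
      \<open>El p q a\<close>.\<close>
    have "cls (El p q a # u @ [x]) = cls (El p q a # El q p (inv a) # u @ [x])"
      using * u(2) x snoc.prems(2-5) by (intro cls_Cons_cong) auto
    also have "\<dots> = cls (El q p (inv a) # u @ [x])"
    proof (intro cls_eqI)
      have "[El p q a, El q p (inv a)] \<approx> [El q p (inv a)]"
        using R1'.intros(2)[of n q p "inv a" M] snoc.prems by (intro eqv_sym[OF R1'_eqv]) (auto simp: distinct_indices_iff)
      from eqv_append[OF this eqv_refl[of "u @ [x]"]]
      show "El p q a # El q p (inv a) # u @ [x] \<approx> El q p (inv a) # u @ [x]" using u(2) x by simp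
    qed
    finally show ?thesis using * by simp
  qed
qed auto

section \<open>Moves through a hole\<close>

lemma hole_cancel:
  assumes "U \<in> C" "i \<in> I" "j \<in> I" "i \<noteq> j" "free j U"
  shows "U \<star> El j i \<one> \<star> El i j \<one> = U"
  using rel2[of U i j \<one>] free_act_same[of U i j \<one>] assms by simp

text \<open>In \<open>rel3\<close> the first letter is inert when \<open>j\<close> is a hole; only
  the product of the units along a round trip matters.\<close>

lemma hole_merge:
  assumes "U \<in> C" "i \<in> I" "j \<in> I" "i \<noteq> j" "a \<in> G" "b \<in> G" "free j U"
  shows "U \<star> El j i a \<star> El i j b = U \<star> El j i \<one> \<star> El i j (a \<otimes> b)"
  using rel3[of U i j a b] free_act_same[of U i j \<one>] assms by simp

lemma hole_slide:
  assumes "U \<in> C" "i \<in> I" "j \<in> I" "k \<in> I" "i \<noteq> j" "k \<noteq> i" "k \<noteq> j" "a \<in> G" "b \<in> G" "free j U"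
  shows "U \<star> El j k a \<star> El i j b = U \<star> El i k (a \<otimes> b)"
  using rel9[of U i j k a b] free_act_same[of "U \<star> El i k (a \<otimes> b)" i j b] assms by simp

text \<open>In \<open>rel10\<close> the extra leading letter on one side is inert when
  \<open>k\<close> is a hole. What remains says that two tokens can be exchanged through
  \<open>k\<close> starting with either of them, which gives the symmetry of
  \<open>sw\<close>.\<close>

lemma hole_swap:
  assumes "U \<in> C" "i \<in> I" "j \<in> I" "k \<in> I" "i \<noteq> j" "k \<noteq> i" "k \<noteq> j" "free k U"
  shows "U \<star> El k i \<one> \<star> El i j \<one> \<star> El j k \<one> = U \<star> El k j \<one> \<star> El j i \<one> \<star> El i k \<one>"
  using rel10[of U i j k] free_act_same[of U i k \<one>] assms by simp

text \<open>Again an inert leading letter, now in \<open>rel11\<close>: exchanging \<open>i\<close>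
  and \<open>j\<close> commutes with filling the hole from \<open>l\<close>, provided that the
  exchange then uses the new hole \<open>l\<close>.\<close>

lemma hole_swap_move:
  assumes "U \<in> C" "i \<in> I" "j \<in> I" "k \<in> I" "l \<in> I" "distinct [i, j, k, l]" "free k U"
  shows "U \<star> El k i \<one> \<star> El i j \<one> \<star> El j k \<one> \<star> El k l \<one> = U \<star> El k l \<one> \<star> El l i \<one> \<star> El i j \<one> \<star> El j l \<one>"
  using rel11[of U i j k l] free_act_same[of U i k \<one>] assms by simp

section \<open>Virtual transpositions\<close>

text \<open>Tokens at \<open>i\<close> and \<open>j\<close> are exchanged through an unoccupied position \<open>k\<close>, whose choice
  turns out to be irrelevant.\<close>

definition sw :: "nat \<Rightarrow> nat \<Rightarrow> ('y, 'a) letter list set \<Rightarrow> ('y, 'a) letter list set"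
  where "sw i j U =
    (if free i U then U \<star> El i j \<one>
     else if free j U then U \<star> El j i \<one>
     else (let k = SOME k. k \<in> I \<and> free k U in U \<star> El k i \<one> \<star> El i j \<one> \<star> El j k \<one>))"

lemma sw_left: "free i U \<Longrightarrow> sw i j U = U \<star> El i j \<one>"
  by (simp add: sw_def)

lemma sw_right:
  assumes "U \<in> C" "i \<in> I" "j \<in> I" "i \<noteq> j" "free j U"
  shows "sw i j U = U \<star> El j i \<one>"
  using assms free_act_same[of U i j \<one>] free_act_same[of U j i \<one>] by (simp add: sw_def)

text \<open>A token sent to \<open>l\<close> may be sent to \<open>k\<close> first and from there to
  \<open>l\<close>. The extra move \<open>El l k \<one>\<close> is disjoint from the move from
  \<open>j\<close> to \<open>i\<close>, so it slides to the end and fuses with the move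
  back.\<close>

lemma swap_hole_irrelevant:
  assumes "U \<in> C" "i \<in> I" "j \<in> I" "k \<in> I" "l \<in> I" "distinct [i, j, k, l]" "free k U" "free l U"
  shows "U \<star> El l i \<one> \<star> El i j \<one> \<star> El j l \<one> = U \<star> El k i \<one> \<star> El i j \<one> \<star> El j k \<one>"
proof -
  have "U \<star> El l i \<one> = U \<star> El k i \<one> \<star> El l k \<one>"
    using hole_slide[of U l k i \<one> \<one>] assms by simp
  moreover have "U \<star> El k i \<one> \<star> El l k \<one> \<star> El i j \<one> = U \<star> El k i \<one> \<star> El i j \<one> \<star> El l k \<one>"
    using assms by (intro rel4) auto
  moreover have "U \<star> El k i \<one> \<star> El i j \<one> \<star> El l k \<one> \<star> El j l \<one> = U \<star> El k i \<one> \<star> El i j \<one> \<star> El j k \<one>"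
    using hole_slide[of "U \<star> El k i \<one> \<star> El i j \<one>" j l k \<one> \<one>] assms by simp
  ultimately show ?thesis by simp
qed

text \<open>Makes the definition of \<open>sw\<close> uniform: the three-move formula is correct for
  every hole outside \<open>{i, j}\<close>, even if \<open>i\<close> or \<open>j\<close> is itself a
  hole.\<close>

lemma sw_third:
  assumes "U \<in> C" "i \<in> I" "j \<in> I" "k \<in> I" "i \<noteq> j" "k \<noteq> i" "k \<noteq> j" "free k U"
  shows "sw i j U = U \<star> El k i \<one> \<star> El i j \<one> \<star> El j k \<one>"
proof -
  consider (i) "free i U" | (j) "free j U" | (n) "\<not> free i U" "\<not> free j U" by blast
  then show ?thesis
  proof cases
    case i
    then show ?thesis
      using assms free_act_same[of U k i \<one>] free_act_same[of "U \<star> El i j \<one>" j k \<one>] by (simp add: sw_left)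
  next
    case j
    then show ?thesis
      using assms free_act_same[of "U \<star> El k i \<one>" i j \<one>] hole_slide[of U j k i \<one> \<one>] by (simp add: sw_right)
  next
    case n
    define l where "l = (SOME l. l \<in> I \<and> free l U)"
    have l: "l \<in> I \<and> free l U" unfolding l_def by (rule someI[of _ k]) (simp add: assms)
    then have "l \<noteq> i" "l \<noteq> j" using n by auto
    moreover have "sw i j U = U \<star> El l i \<one> \<star> El i j \<one> \<star> El j l \<one>"
      using n by (simp add: sw_def l_def Let_def)
    ultimately show ?thesis using swap_hole_irrelevant[of U i j k l] assms l by (cases "l = k") simp_all
  qed
qed

lemma sw_cases [consumes 4, case_names left right third]:
  assumes "U \<in> C" "i \<in> I" "j \<in> I" "i \<noteq> j"
  obtains "free i U" "sw i j U = U \<star> El i j \<one>"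
    | "free j U" "sw i j U = U \<star> El j i \<one>"
    | k where "k \<in> I" "k \<noteq> i" "k \<noteq> j" "free k U" "sw i j U = U \<star> El k i \<one> \<star> El i j \<one> \<star> El j k \<one>"
proof -
  obtain k where "k \<in> I" "free k U" using assms(1) by (rule free_ex)
  then show ?thesis
    using sw_left[of i U j] sw_right[OF assms] sw_third[OF assms(1-3) _ assms(4)] that by (cases "k = i"; cases "k = j") simp_all
qed

lemma sw_C [simp]:
  assumes "U \<in> C" "i \<in> I" "j \<in> I" "i \<noteq> j"
  shows "sw i j U \<in> C"
  using assms by (cases rule: sw_cases) (use assms in simp_all)

lemma free_not_posc: "free k U \<Longrightarrow> p \<in> I \<Longrightarrow> posc U p \<noteq> k"
  unfolding free_def by blast

lemma posc_sw:
  assumes "U \<in> C" "i \<in> I" "j \<in> I" "i \<noteq> j" "p \<in> I"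
  shows "posc (sw i j U) p = transpose i j (posc U p)"
  using assms(1-4) by (cases rule: sw_cases) (use assms free_not_posc in \<open>auto simp: transpose_def\<close>)

lemma labc_sw:
  assumes "U \<in> C" "i \<in> I" "j \<in> I" "i \<noteq> j" "p \<in> I"
  shows "labc (sw i j U) p = labc U p"
  using assms(1-4) by (cases rule: sw_cases) (use assms in simp_all)

lemma free_sw:
  assumes "U \<in> C" "i \<in> I" "j \<in> I" "i \<noteq> j"
  shows "free k (sw i j U) \<longleftrightarrow> free (transpose i j k) U"
proof -
  have "posc (sw i j U) ` I = transpose i j ` posc U ` I"
    using posc_sw[OF assms] by (simp add: image_image)
  then show ?thesis
    unfolding free_def by (metis (no_types, lifting) imageE imageI transpose_involutory)
qed

lemma sw_commute:
  assumes "U \<in> C" "i \<in> I" "j \<in> I" "i \<noteq> j"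
  shows "sw i j U = sw j i U"
  using assms by (cases rule: sw_cases) (use assms hole_swap sw_left sw_right sw_third in auto)

lemma sw_sw:
  assumes "U \<in> C" "i \<in> I" "j \<in> I" "i \<noteq> j"
  shows "sw i j (sw i j U) = U"
  using assms
proof (cases rule: sw_cases)
  case left
  then show ?thesis using assms hole_cancel[of U j i] by (simp add: sw_right)
next
  case right
  then show ?thesis using assms hole_cancel[of U i j] by (simp add: sw_left)
next
  case (third k)
  \<comment> \<open>With the indices reversed, the second exchange undoes the three moves of the
    first in reverse order.\<close>
  have "sw i j (sw i j U) = sw j i (sw i j U)" using assms by (intro sw_commute) simp_all
  also have "\<dots> = sw i j U \<star> El k j \<one> \<star> El j i \<one> \<star> El i k \<one>"
    using assms third by (intro sw_third) simp_all
  also have "\<dots> = U \<star> El k i \<one> \<star> El i j \<one> \<star> El j k \<one> \<star> El k j \<one> \<star> El j i \<one> \<star> El i k \<one>"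
    using third by simp
  also have "\<dots> = U"
    using assms third hole_cancel[of "U \<star> El k i \<one> \<star> El i j \<one>" k j] hole_cancel[of "U \<star> El k i \<one>" j i]
      hole_cancel[of U i k] by simp
  finally show ?thesis .
qed

lemma sw_hole_move:
  assumes "U \<in> C" "i \<in> I" "j \<in> I" "k \<in> I" "l \<in> I" "distinct [i, j, k, l]" "free k U"
  shows "sw i j (U \<star> El k l \<one>) = sw i j U \<star> El k l \<one>"
  using assms hole_swap_move[OF assms] by (simp add: sw_third[of _ i j l] sw_third[of _ i j k])

lemma sw_comm_hole:
  assumes "U \<in> C" "i \<in> I" "j \<in> I" "k \<in> I" "l \<in> I" "distinct [i, j, k, l]"
    and "h' \<in> I" "free h' U" "h' \<noteq> i" "h' \<noteq> j"
  shows "sw i j (sw k l U) = sw k l (sw i j U)"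
proof -
  have f: "free h' (sw i j U)" using assms free_sw by simp
  consider "h' = k" | "h' = l" | "h' \<noteq> k" "h' \<noteq> l" by blast
  then show ?thesis
  proof cases
    case 1
    then show ?thesis using assms f by (simp add: sw_left sw_hole_move)
  next
    case 2
    then show ?thesis using assms f by (simp add: sw_right sw_hole_move)
  next
    case 3
    then have "sw i j (sw k l U) = sw i j U \<star> El h' k \<one> \<star> El k l \<one> \<star> El l h' \<one>"
      using assms by (simp add: sw_third[of U k l h'] sw_hole_move)
    then show ?thesis using assms f 3 by (simp add: sw_third[of "sw i j U" k l h'])
  qed
qed

text \<open>Any hole lies outside at least one of the two pairs, so \<open>sw_comm_hole\<close>
  applies in one of the two orders.\<close>

lemma sw_comm:
  assumes "U \<in> C" "i \<in> I" "j \<in> I" "k \<in> I" "l \<in> I" "distinct [i, j, k, l]"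
  shows "sw i j (sw k l U) = sw k l (sw i j U)"
proof -
  obtain h' where h': "h' \<in> I" "free h' U" using assms(1) by (rule free_ex)
  show ?thesis
  proof (cases "h' = i \<or> h' = j")
    case True
    then show ?thesis using assms h' by (intro sw_comm_hole[of U k l i j h', symmetric]) auto
  next
    case False
    then show ?thesis using assms h' by (intro sw_comm_hole[of U i j k l h']) auto
  qed
qed

text \<open>Conjugation in the symmetric group: exchanging \<open>i, j\<close> and then
  \<open>j, k\<close> equals exchanging \<open>j, k\<close> and then \<open>i, k\<close>. The hole
  may be any of the three positions or lie outside them.\<close>

lemma sw_braid:
  assumes "U \<in> C" "i \<in> I" "j \<in> I" "k \<in> I" "distinct [i, j, k]"
  shows "sw j k (sw i j U) = sw i k (sw j k U)"
proof -
  obtain h' where h': "h' \<in> I" "free h' U" using assms(1) by (rule free_ex)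
  consider "h' = i" | "h' = j" | "h' = k" | "h' \<noteq> i" "h' \<noteq> j" "h' \<noteq> k" by blast
  then show ?thesis
  proof cases
    case 1
    then show ?thesis using assms h' hole_cancel[of "U \<star> El i j \<one> \<star> El j k \<one>" i k]
      by (simp add: sw_left sw_third[of U j k i])
  next
    case 2
    have "sw j k (sw i j U) = U \<star> El j i \<one> \<star> El i j \<one> \<star> El j k \<one> \<star> El k i \<one>"
      using assms h' 2 by (simp add: sw_right sw_third[of _ j k i])
    also have "\<dots> = U \<star> El j k \<one> \<star> El k i \<one>" using assms h' 2 hole_cancel[of U i j] by simp
    also have "\<dots> = sw i k (sw j k U)" using assms h' 2 by (simp add: sw_left[of j] sw_right[of _ i k])
    finally show ?thesis .
  next
    case 3
    have "sw j k (sw i j U) = U \<star> El k i \<one> \<star> El i j \<one> \<star> El j k \<one> \<star> El k j \<one>"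
      using assms h' 3 by (simp add: sw_right sw_third[of _ i j k])
    also have "\<dots> = U \<star> El k i \<one> \<star> El i j \<one>"
      using assms h' 3 hole_cancel[of "U \<star> El k i \<one> \<star> El i j \<one>" k j] by simp
    also have "\<dots> = U \<star> El k j \<one> \<star> El j k \<one> \<star> El k i \<one> \<star> El i j \<one>"
      using assms h' 3 hole_cancel[of U j k] by simp
    also have "\<dots> = sw k i (sw j k U)"
      using assms h' 3 by (simp add: sw_right[of _ j k] sw_third[of _ k i j])
    also have "\<dots> = sw i k (sw j k U)" using assms by (intro sw_commute) simp_all
    finally show ?thesis .
  next
    case 4
    have "sw j k (sw i j U) = U \<star> El h' i \<one> \<star> El i j \<one> \<star> El j h' \<one> \<star> El h' j \<one> \<star> El j k \<one> \<star> El k h' \<one>"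
      using assms h' 4 by (simp add: sw_third[of _ i j h'] sw_third[of _ j k h'])
    also have "\<dots> = U \<star> El h' i \<one> \<star> El i j \<one> \<star> El j k \<one> \<star> El k h' \<one>"
      using assms h' 4 hole_cancel[of "U \<star> El h' i \<one> \<star> El i j \<one>" h' j] by simp
    \<comment> \<open>A detour of the token at \<open>i\<close> to \<open>k\<close> and back is
      inserted. It exhibits an exchange of \<open>j\<close> and \<open>k\<close> through the hole
      \<open>i\<close>, left by moving a token to \<open>h'\<close>, and \<open>sw_hole_move\<close>
      takes this exchange to the front.\<close>
    also have "\<dots> = U \<star> El h' i \<one> \<star> El i j \<one> \<star> El j k \<one> \<star> El k i \<one> \<star> El i k \<one> \<star> El k h' \<one>"
      using assms h' 4 hole_cancel[of "U \<star> El h' i \<one> \<star> El i j \<one> \<star> El j k \<one>" i k] by simp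
    also have "\<dots> = sw j k (U \<star> El h' i \<one>) \<star> El i k \<one> \<star> El k h' \<one>"
      using assms h' 4 by (simp add: sw_third[of _ j k i])
    also have "\<dots> = sw j k U \<star> El h' i \<one> \<star> El i k \<one> \<star> El k h' \<one>"
      using assms h' 4 by (simp add: sw_hole_move)
    also have "\<dots> = sw i k (sw j k U)"
      using assms h' 4 by (simp add: sw_third[of "sw j k U" i k h'] free_sw)
    finally show ?thesis .
  qed
qed

section \<open>Virtual scalars\<close>

text \<open>A scalar is produced by a round trip through a hole. At an unoccupied position it is the
  identity, so that the commutation rules hold without side conditions on occupancy.\<close>

definition gm :: "nat \<Rightarrow> 'a \<Rightarrow> ('y, 'a) letter list set \<Rightarrow> ('y, 'a) letter list set"
  where "gm i a U =
    (if free i U then U else (let j = SOME j. j \<in> I \<and> free j U in U \<star> El j i \<one> \<star> El i j a))"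

lemma gm_free [simp]: "free i U \<Longrightarrow> gm i a U = U"
  by (simp add: gm_def)

text \<open>Independence of the hole: a trip to \<open>j\<close> is split as a trip to
  \<open>k\<close> followed by one to \<open>j\<close>; \<open>rel9\<close> shortens the way back,
  leaving only an inert move.\<close>

lemma gm_hole:
  assumes "U \<in> C" "i \<in> I" "j \<in> I" "i \<noteq> j" "a \<in> G" "free j U"
  shows "gm i a U = U \<star> El j i \<one> \<star> El i j a"
proof (cases "free i U")
  case True
  then show ?thesis using assms free_act_same[of U j i \<one>] free_act_same[of U i j a] by simp
next
  case False
  define k where "k = (SOME k. k \<in> I \<and> free k U)"
  have k: "k \<in> I \<and> free k U" unfolding k_def by (rule someI[of _ j]) (simp add: assms)
  have gm: "gm i a U = U \<star> El k i \<one> \<star> El i k a" using False by (simp add: gm_def k_def Let_def)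
  show ?thesis
  proof (cases "k = j")
    case False
    have ki: "k \<noteq> i" using k \<open>\<not> free i U\<close> by auto
    have "U \<star> El j i \<one> \<star> El i j a = U \<star> El k i \<one> \<star> El j k \<one> \<star> El i j a"
      using hole_slide[of U j k i \<one> \<one>] assms k ki False by simp
    also have "\<dots> = U \<star> El k i \<one> \<star> El i k a \<star> El i j a"
      using rel9[of "U \<star> El k i \<one>" i j k \<one> a] assms k ki False by simp
    also have "\<dots> = U \<star> El k i \<one> \<star> El i k a"
      using assms k ki False by (intro free_act_same) auto
    finally show ?thesis using gm by simp
  qed (simp add: gm)
qed

lemma gm_cases [consumes 3, case_names free hole]:
  assumes "U \<in> C" "i \<in> I" "a \<in> G"
  obtains "free i U" "gm i a U = U"
    | j where "\<not> free i U" "j \<in> I" "j \<noteq> i" "free j U" "gm i a U = U \<star> El j i \<one> \<star> El i j a"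
proof (cases "free i U")
  case False
  obtain j where j: "j \<in> I" "free j U" using assms(1) by (rule free_ex)
  with False have "j \<noteq> i" by auto
  then show ?thesis using gm_hole[of U i j a] that(2)[of j] False assms j by simp
qed (use that(1) in simp)

lemma gm_C [simp]:
  assumes "U \<in> C" "i \<in> I" "a \<in> G"
  shows "gm i a U \<in> C"
  using assms by (cases rule: gm_cases) (use assms in simp_all)

lemma posc_gm:
  assumes "U \<in> C" "i \<in> I" "a \<in> G" "p \<in> I"
  shows "posc (gm i a U) p = posc U p"
  using assms(1-3) by (cases rule: gm_cases) (use assms free_not_posc in auto)

lemma labc_gm:
  assumes "U \<in> C" "i \<in> I" "a \<in> G" "p \<in> I"
  shows "labc (gm i a U) p = labc U p \<otimes> (if posc U p = i then a else \<one>)"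
  using assms(1-3) by (cases rule: gm_cases) (use assms free_not_posc in auto)

lemma free_gm [simp]:
  assumes "U \<in> C" "i \<in> I" "a \<in> G"
  shows "free k (gm i a U) \<longleftrightarrow> free k U"
  unfolding free_def using posc_gm[OF assms] by (metis (no_types, lifting) image_cong)

lemma gm_one:
  assumes "U \<in> C" "i \<in> I"
  shows "gm i \<one> U = U"
  using assms(1,2) Units_one_closed by (cases rule: gm_cases) (use assms hole_cancel in auto)

lemma gm_gm:
  assumes "U \<in> C" "i \<in> I" "a \<in> G" "b \<in> G"
  shows "gm i b (gm i a U) = gm i (a \<otimes> b) U"
  using assms(1-3)
proof (cases rule: gm_cases)
  case (hole j)
  have "gm i b (gm i a U) = gm i a U \<star> El j i \<one> \<star> El i j b"
    using assms hole by (intro gm_hole) simp_all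
  also have "\<dots> = U \<star> El j i \<one> \<star> El i j a \<star> El j i \<one> \<star> El i j b"
    using hole by simp
  also have "\<dots> = U \<star> El j i \<one> \<star> El i j \<one> \<star> El j i a \<star> El i j b"
    using hole_merge[of "U \<star> El j i \<one>" j i a \<one>] assms hole by simp
  also have "\<dots> = U \<star> El j i a \<star> El i j b"
    using hole_cancel[of U i j] assms hole by simp
  also have "\<dots> = U \<star> El j i \<one> \<star> El i j (a \<otimes> b)"
    using hole_merge[of U i j a b] assms hole by simp
  also have "\<dots> = gm i (a \<otimes> b) U"
    using assms hole by (intro gm_hole[symmetric]) simp_all
  finally show ?thesis .
qed (simp add: assms)

text \<open>The scalar at \<open>j\<close> uses the hole \<open>i\<close> before the move and the
  hole \<open>k\<close> after it. Relation \<open>rel7\<close> performs exactly this change of hole;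
  the letter it needs in front is supplied by doubling \<open>El i j \<one>\<close> with
  \<open>rel1\<close>.\<close>

lemma gm_hop:
  assumes "U \<in> C" "i \<in> I" "j \<in> I" "k \<in> I" "distinct [i, j, k]" "a \<in> G" "b \<in> G" "free i U"
  shows "gm j a (U \<star> El i k b) = gm j a U \<star> El i k b"
proof -
  let ?V = "U \<star> El i j \<one>"
  have "gm j a U \<star> El i k b = ?V \<star> El i j \<one> \<star> El j i a \<star> El i k b"
    using assms by (simp add: gm_hole[of U j i] rel1)
  also have "\<dots> = ?V \<star> El j i \<one> \<star> El i k b \<star> El k j a \<star> El j k \<one>"
    using assms by (intro rel7) auto
  also have "\<dots> = U \<star> El i k b \<star> El k j a \<star> El j k \<one>"
    using assms hole_cancel[of U j i] by simp
  also have "\<dots> = U \<star> El i k b \<star> El k j \<one> \<star> El j k a"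
    using assms hole_merge[of "U \<star> El i k b" j k a \<one>] by simp
  also have "\<dots> = gm j a (U \<star> El i k b)"
    using assms by (simp add: gm_hole[of _ j k])
  finally show ?thesis by simp
qed

text \<open>Three successive moves between \<open>i\<close> and \<open>j\<close> can be bracketed in
  two ways as a round trip and a single move; \<open>hole_merge\<close> shifts the unit from the
  second move to the third.\<close>

lemma gm_slide:
  assumes "U \<in> C" "i \<in> I" "j \<in> I" "i \<noteq> j" "a \<in> G" "free j U"
  shows "gm i a U \<star> El j i \<one> = gm j a (U \<star> El j i \<one>)"
proof -
  have "gm i a U \<star> El j i \<one> = U \<star> El j i \<one> \<star> El i j a \<star> El j i \<one>"
    using assms by (simp add: gm_hole)
  also have "\<dots> = U \<star> El j i \<one> \<star> El i j \<one> \<star> El j i a"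
    using hole_merge[of "U \<star> El j i \<one>" j i a \<one>] assms by simp
  also have "\<dots> = gm j a (U \<star> El j i \<one>)"
    using assms by (simp add: gm_hole[of _ j i])
  finally show ?thesis .
qed

text \<open>Every letter that moves a token into a hole is thus a transposition followed by a
  scalar, the link between actual words and the virtual operations.\<close>

lemma act_eq_gm_sw:
  assumes "U \<in> C" "i \<in> I" "j \<in> I" "i \<noteq> j" "a \<in> G" "free i U"
  shows "U \<star> El i j a = gm i a (sw i j U)"
  using assms hole_cancel[of U j i] by (simp add: sw_left gm_hole[of _ i j])

lemma gm_comm:
  assumes "U \<in> C" "i \<in> I" "j \<in> I" "i \<noteq> j" "a \<in> G" "b \<in> G"
  shows "gm i a (gm j b U) = gm j b (gm i a U)"
proof (cases "free i U \<or> free j U")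
  case True
  then show ?thesis using assms by auto
next
  case False
  obtain k where k: "k \<in> I" "free k U" using assms(1) by (rule free_ex)
  then have kij: "k \<noteq> i" "k \<noteq> j" using False by auto
  have "gm i a (gm j b U) = gm j b U \<star> El k i \<one> \<star> El i k a"
    using assms k kij by (intro gm_hole) auto
  also have "\<dots> = gm j b (U \<star> El k i \<one>) \<star> El i k a"
    using assms k kij by (simp add: gm_hop)
  also have "\<dots> = gm j b (U \<star> El k i \<one> \<star> El i k a)"
    using assms k kij by (simp add: gm_hop)
  also have "\<dots> = gm j b (gm i a U)"
    using assms k kij by (simp add: gm_hole[of U i k])
  finally show ?thesis .
qed

lemma sw_gm_other:
  assumes "U \<in> C" "i \<in> I" "j \<in> I" "k \<in> I" "distinct [i, j, k]" "a \<in> G"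
  shows "sw i j (gm k a U) = gm k a (sw i j U)"
proof (cases "free k U")
  case True
  then show ?thesis using assms by (simp add: free_sw transpose_def)
next
  case False
  obtain l where l: "l \<in> I" "free l U" using assms(1) by (rule free_ex)
  consider "l = i" | "l = j" | "l \<noteq> i" "l \<noteq> j" by blast
  then show ?thesis
  proof cases
    case 1
    then show ?thesis using assms l by (simp add: sw_left gm_hop)
  next
    case 2
    then show ?thesis using assms l by (simp add: sw_right gm_hop)
  next
    case 3
    then show ?thesis using assms l False by (cases "l = k") (simp_all add: sw_third[of _ i j l] gm_hop)
  qed
qed

lemma sw_gm_same:
  assumes "U \<in> C" "i \<in> I" "j \<in> I" "i \<noteq> j" "a \<in> G"
  shows "sw i j (gm i a U) = gm j a (sw i j U)"
proof (cases "free i U")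
  case True
  then show ?thesis using assms by (simp add: free_sw transpose_def)
next
  case False
  obtain l where l: "l \<in> I" "free l U" "l \<noteq> i" using free_ex assms False by metis
  show ?thesis
  proof (cases "l = j")
    case True
    then have "sw i j (gm i a U) = gm i a U \<star> El j i \<one>"
      using assms l by (simp add: sw_right)
    also have "\<dots> = gm j a (sw i j U)"
      using assms l True by (simp add: sw_right gm_slide)
    finally show ?thesis .
  next
    case False
    have "sw i j (gm i a U) = gm i a U \<star> El l i \<one> \<star> El i j \<one> \<star> El j l \<one>"
      using assms l False by (simp add: sw_third[of _ i j l])
    also have "\<dots> = gm l a (U \<star> El l i \<one>) \<star> El i j \<one> \<star> El j l \<one>"
      using assms l False by (simp add: gm_slide)
    also have "\<dots> = gm l a (U \<star> El l i \<one> \<star> El i j \<one>) \<star> El j l \<one>"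
      using assms l False by (simp add: gm_hop)
    also have "\<dots> = gm j a (U \<star> El l i \<one> \<star> El i j \<one> \<star> El j l \<one>)"
      using assms l False by (simp add: gm_slide)
    also have "\<dots> = gm j a (sw i j U)"
      using assms l False by (simp add: sw_third[of _ i j l])
    finally show ?thesis .
  qed
qed

lemma sw_gm:
  assumes "U \<in> C" "i \<in> I" "j \<in> I" "i \<noteq> j" "k \<in> I" "a \<in> G"
  shows "sw i j (gm k a U) = gm (transpose i j k) a (sw i j U)"
proof -
  consider "k = i" | "k = j" | "k \<noteq> i" "k \<noteq> j" by blast
  then show ?thesis
  proof cases
    case 1
    then show ?thesis using assms sw_gm_same by simp
  next
    case 2
    then show ?thesis using assms sw_gm_same[of U j i a] by (simp add: sw_commute[of _ i j])
  next
    case 3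
    then show ?thesis using assms sw_gm_other by (simp add: transpose_def)
  qed
qed

section \<open>Words over \<open>X1\<close>\<close>

fun sws :: "(nat \<times> nat) list \<Rightarrow> ('y, 'a) letter list set \<Rightarrow> ('y, 'a) letter list set" where
  "sws [] U = U"
| "sws ((i, j) # ps) U = sws ps (sw i j U)"

fun perm :: "(nat \<times> nat) list \<Rightarrow> nat \<Rightarrow> nat" where
  "perm [] p = p"
| "perm ((i, j) # ps) p = perm ps (transpose i j p)"

definition pairs :: "nat set \<Rightarrow> (nat \<times> nat) set"
  where "pairs A = {(i, j). i \<in> A \<and> j \<in> A \<and> i \<noteq> j}"

lemma pairs_iff [simp]: "(i, j) \<in> pairs A \<longleftrightarrow> i \<in> A \<and> j \<in> A \<and> i \<noteq> j"
  by (simp add: pairs_def)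

lemma sws_C: "ps \<in> lists (pairs I) \<Longrightarrow> U \<in> C \<Longrightarrow> sws ps U \<in> C"
  by (induction ps U rule: sws.induct) auto

lemma sws_append: "sws (ps @ qs) U = sws qs (sws ps U)"
  by (induction ps U rule: sws.induct) auto

lemma perm_append: "perm (ps @ qs) p = perm qs (perm ps p)"
  by (induction ps p rule: perm.induct) auto

lemma perm_in: "ps \<in> lists (pairs A) \<Longrightarrow> p \<in> A \<Longrightarrow> perm ps p \<in> A"
  by (induction ps p rule: perm.induct) (auto simp: transpose_def)

lemma perm_rev: "perm ps (perm (rev ps) p) = p"
proof (induction ps arbitrary: p)
  case (Cons x ps)
  then show ?case by (cases x) (simp add: perm_append)
qed simp

lemma sws_rev: "ps \<in> lists (pairs I) \<Longrightarrow> U \<in> C \<Longrightarrow> sws (rev ps) (sws ps U) = U"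
proof (induction ps arbitrary: U)
  case (Cons x ps)
  obtain i j where "x = (i, j)" by (cases x)
  then show ?case using Cons by (simp add: sws_append sw_sw)
qed simp

lemma posc_sws: "ps \<in> lists (pairs I) \<Longrightarrow> U \<in> C \<Longrightarrow> p \<in> I \<Longrightarrow> posc (sws ps U) p = perm ps (posc U p)"
  by (induction ps U rule: sws.induct) (auto simp: posc_sw)

lemma labc_sws: "ps \<in> lists (pairs I) \<Longrightarrow> U \<in> C \<Longrightarrow> p \<in> I \<Longrightarrow> labc (sws ps U) p = labc U p"
  by (induction ps U rule: sws.induct) (auto simp: labc_sw)

text \<open>The decomposition of the symmetric group on \<open>insert x A\<close> into cosets of the
  one on \<open>A\<close>: at most one transposition moving \<open>x\<close> survives, and it is
  applied first. Permutation and action are rewritten by the same steps, so one \<open>qs\<close>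
  serves both.\<close>

lemma sws_reduce:
  assumes "insert x A \<subseteq> I" "x \<notin> A" "ps \<in> lists (pairs (insert x A))"
  shows "\<exists>qs\<in>lists (pairs A).
    (\<forall>p. perm ps p = perm qs p) \<and> (\<forall>U\<in>C. sws ps U = sws qs U) \<or>
    (\<exists>a\<in>A. (\<forall>p. perm ps p = perm qs (transpose x a p)) \<and> (\<forall>U\<in>C. sws ps U = sws qs (sw x a U)))"
  using assms(3)
proof (induction ps rule: list.induct)
  case Nil
  show ?case by (intro bexI[of _ "[]"]) auto
next
  case (Cons t ps)
  obtain b c where bc: "t = (b, c)" by (cases t)
  have "(b, c) \<in> pairs (insert x A)" using Cons.prems unfolding bc by simp
  then have t: "t = (b, c)" "b \<in> insert x A" "c \<in> insert x A" "b \<noteq> c"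
    using bc by simp_all
  then have bcI: "b \<in> I" "c \<in> I" using assms(1) by auto
  have AI: "y \<in> I" if "y \<in> A" for y using assms(1) that by auto
  have xI: "x \<in> I" using assms(1) by simp
  obtain qs where qs: "qs \<in> lists (pairs A)"
    and alt: "(\<forall>p. perm ps p = perm qs p) \<and> (\<forall>U\<in>C. sws ps U = sws qs U) \<or>
      (\<exists>a\<in>A. (\<forall>p. perm ps p = perm qs (transpose x a p)) \<and> (\<forall>U\<in>C. sws ps U = sws qs (sw x a U)))"
    using Cons by auto
  show ?case
  proof (cases "b = x \<or> c = x")
    case True
    obtain c' where c': "c' \<in> A" "c' \<noteq> x" "transpose b c = transpose x c'" "\<forall>U\<in>C. sw b c U = sw x c' U"
    proof (cases "b = x")
      case True
      then show ?thesis using that[of c] t by auto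
    next
      case False
      then have "c = x" using True by simp
      then show ?thesis using that[of b] t False bcI sw_commute by (auto simp: transpose_commute)
    qed
    have t': "perm (t # ps) p = perm ps (transpose x c' p)" "U \<in> C \<Longrightarrow> sws (t # ps) U = sws ps (sw x c' U)" for p U
      using c' t by auto
    have c'I: "c' \<in> I" using c' AI by simp
    from alt show ?thesis
    proof (elim disjE bexE conjE)
      assume "\<forall>p. perm ps p = perm qs p" "\<forall>U\<in>C. sws ps U = sws qs U"
      then show ?thesis
        using t' c' c'I xI by (intro bexI[OF _ qs] disjI2 bexI[OF _ c'(1)]) auto
    next
      fix a assume a: "a \<in> A" "\<forall>p. perm ps p = perm qs (transpose x a p)" "\<forall>U\<in>C. sws ps U = sws qs (sw x a U)"
      have aI: "a \<in> I" "a \<noteq> x" using a AI assms(2) by auto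
      show ?thesis
      proof (cases "a = c'")
        case True
        then show ?thesis
          using t' a c' c'I xI by (intro bexI[OF _ qs] disjI1) (auto simp: sw_sw)
      next
        case False
        \<comment> \<open>Two consecutive transpositions moving \<open>x\<close> are traded by the
          braid rule for one that does, followed by one inside \<open>A\<close>.\<close>
        have "transpose x a (transpose x c' p) = transpose c' a (transpose x a p)" for p
          using False aI c' by (auto simp: transpose_def)
        moreover have "sw x a (sw x c' U) = sw c' a (sw x a U)" if "U \<in> C" for U
          using sw_braid[of U c' x a] sw_commute[of U x c'] that False aI c' c'I xI by simp
        ultimately show ?thesis
          using t' a c' c'I xI qs False
          by (intro bexI[of _ "(c', a) # qs"] disjI2 bexI[OF _ a(1)]) auto
      qed
    qed
  next
    case False
    then have bc: "b \<in> A" "c \<in> A" using t by auto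
    from alt show ?thesis
    proof (elim disjE bexE conjE)
      assume "\<forall>p. perm ps p = perm qs p" "\<forall>U\<in>C. sws ps U = sws qs U"
      then show ?thesis
        using t bc bcI qs by (intro bexI[of _ "(b, c) # qs"] disjI1) auto
    next
      fix a assume a: "a \<in> A" "\<forall>p. perm ps p = perm qs (transpose x a p)" "\<forall>U\<in>C. sws ps U = sws qs (sw x a U)"
      have aI: "a \<in> I" "a \<noteq> x" using a AI assms(2) by auto
      \<comment> \<open>Conjugating the transposition of \<open>x\<close> and \<open>a\<close> by
        that of \<open>b\<close> and \<open>c\<close> replaces \<open>a\<close> by its
        image.\<close>
      define a' where "a' = transpose b c a"
      have a': "a' \<in> A" using a bc by (auto simp: a'_def transpose_def)
      have "transpose x a (transpose b c p) = transpose b c (transpose x a' p)" for p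
        using aI False t(4) by (auto simp: transpose_def a'_def)
      moreover have "sw x a (sw b c U) = sw b c (sw x a' U)" if "U \<in> C" for U
      proof -
        consider "a = b" | "a = c" | "a \<noteq> b" "a \<noteq> c" by blast
        then show ?thesis
        proof cases
          case 1
          have "sw x b (sw c b U) = sw c b (sw x c U)"
            using that aI False t(4) bcI xI by (intro sw_braid[symmetric]) auto
          then show ?thesis using 1 that aI False t(4) bcI xI by (simp add: a'_def sw_commute[of _ b c])
        next
          case 2
          have "sw x c (sw b c U) = sw b c (sw x b U)"
            using that aI False t(4) bcI xI by (intro sw_braid[symmetric]) auto
          then show ?thesis using 2 by (simp add: a'_def)
        next
          case 3
          have "sw x a (sw b c U) = sw b c (sw x a U)"
            using 3 that aI False t(4) bcI xI by (intro sw_comm) auto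
          then show ?thesis using 3 by (simp add: a'_def transpose_def)
        qed
      qed
      ultimately show ?thesis
        using t a bc bcI qs by (intro bexI[of _ "(b, c) # qs"] disjI2 bexI[OF _ a']) auto
    qed
  qed
qed

text \<open>The fixed points in \<open>A\<close> are removed one at a time. A surviving
  transposition of \<open>x\<close> with \<open>a\<close> would send \<open>x\<close> to the image
  of \<open>a\<close> under \<open>qs\<close>, which lies in \<open>A \<union> B\<close> and so
  differs from \<open>x\<close>.\<close>

lemma sws_eliminate:
  assumes "finite A" "A \<inter> B = {}" "A \<union> B \<subseteq> I" "ps \<in> lists (pairs (A \<union> B))" "\<And>p. p \<in> A \<Longrightarrow> perm ps p = p"
  shows "\<exists>qs\<in>lists (pairs B). \<forall>U\<in>C. sws ps U = sws qs U"
  using assms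
proof (induction A arbitrary: ps rule: finite_induct)
  case empty
  then show ?case by auto
next
  case (insert x A)
  have x: "insert x (A \<union> B) \<subseteq> I" "x \<notin> A \<union> B" "ps \<in> lists (pairs (insert x (A \<union> B)))"
    using insert by auto
  obtain qs where qs: "qs \<in> lists (pairs (A \<union> B))"
    and alt: "(\<forall>p. perm ps p = perm qs p) \<and> (\<forall>U\<in>C. sws ps U = sws qs U) \<or>
      (\<exists>a\<in>A \<union> B. (\<forall>p. perm ps p = perm qs (transpose x a p)) \<and> (\<forall>U\<in>C. sws ps U = sws qs (sw x a U)))"
    using sws_reduce[OF x] by blast
  have "perm ps x \<noteq> perm qs (transpose x a x)" if "a \<in> A \<union> B" for a
    using perm_in[OF qs that] x(2) insert.prems(4)[of x] by auto
  then have *: "\<forall>p. perm ps p = perm qs p" "\<forall>U\<in>C. sws ps U = sws qs U" using alt by blast+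
  have "\<exists>rs\<in>lists (pairs B). \<forall>U\<in>C. sws qs U = sws rs U"
    using insert.prems * by (intro insert.IH qs) auto
  then show ?case using * by auto
qed

lemma sws_free: "ps \<in> lists (pairs B) \<Longrightarrow> B \<subseteq> I \<Longrightarrow> U \<in> C \<Longrightarrow> (\<And>b. b \<in> B \<Longrightarrow> free b U) \<Longrightarrow> sws ps U = U"
proof (induction ps)
  case (Cons t ps)
  obtain b c where t: "t = (b, c)" "b \<in> B" "c \<in> B" "b \<noteq> c" using Cons.prems(1) by (cases t) auto
  then have "sw b c U = U" using Cons.prems free_act_same[of U b c \<one>] by (auto simp: sw_left)
  then show ?case using Cons t by simp
qed simp

text \<open>Following \<open>ps\<close> by the inverse of \<open>qs\<close> fixes every occupied
  position. It therefore reduces to transpositions among holes, which act trivially.\<close>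

lemma sws_eqI:
  assumes "ps \<in> lists (pairs I)" "qs \<in> lists (pairs I)" "U \<in> C"
    and eq: "\<And>p. p \<in> I \<Longrightarrow> \<not> free p U \<Longrightarrow> perm ps p = perm qs p"
  shows "sws ps U = sws qs U"
proof -
  define A where "A = {p \<in> I. \<not> free p U}"
  define B where "B = {p \<in> I. free p U}"
  have AB: "A \<union> B = I" by (auto simp: A_def B_def)
  have rq: "rev qs \<in> lists (pairs I)" using assms(2) by auto
  have "\<exists>rs\<in>lists (pairs B). \<forall>U\<in>C. sws (ps @ rev qs) U = sws rs U"
  proof (rule sws_eliminate)
    show "perm (ps @ rev qs) p = p" if "p \<in> A" for p
      using that eq perm_rev[of "rev qs" p] by (auto simp: A_def perm_append)
    show "ps @ rev qs \<in> lists (pairs (A \<union> B))" unfolding AB using assms rq by simp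
  qed (auto simp: A_def B_def)
  then obtain rs where rs: "rs \<in> lists (pairs B)" "sws (ps @ rev qs) U = sws rs U" using assms(3) by blast
  have "sws (rev qs) (sws ps U) = sws rs U" using rs(2) by (simp add: sws_append)
  also have "\<dots> = U" using rs(1) assms(3) by (intro sws_free[of _ B]) (auto simp: B_def)
  finally have "sws (rev (rev qs)) (sws (rev qs) (sws ps U)) = sws qs U" by simp
  then show ?thesis using sws_rev[OF rq] sws_C[OF assms(1,3)] by simp
qed

section \<open>Products of scalars\<close>

primrec gms :: "nat list \<Rightarrow> (nat \<Rightarrow> 'a) \<Rightarrow> ('y, 'a) letter list set \<Rightarrow> ('y, 'a) letter list set" where
  "gms [] d U = U"
| "gms (i # is) d U = gms is d (gm i (d i) U)"

lemma gms_C [simp]: "set is \<subseteq> I \<Longrightarrow> range d \<subseteq> G \<Longrightarrow> U \<in> C \<Longrightarrow> gms is d U \<in> C"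
  by (induction "is" arbitrary: U) (auto simp: image_subset_iff)

lemma posc_gms [simp]: "set is \<subseteq> I \<Longrightarrow> range d \<subseteq> G \<Longrightarrow> U \<in> C \<Longrightarrow> p \<in> I \<Longrightarrow> posc (gms is d U) p = posc U p"
  by (induction "is" arbitrary: U) (auto simp: posc_gm image_subset_iff)

lemma free_gms [simp]: "set is \<subseteq> I \<Longrightarrow> range d \<subseteq> G \<Longrightarrow> U \<in> C \<Longrightarrow> free k (gms is d U) = free k U"
  by (induction "is" arbitrary: U) (auto simp: image_subset_iff)

lemma labc_gms:
  "set is \<subseteq> I \<Longrightarrow> distinct is \<Longrightarrow> range d \<subseteq> G \<Longrightarrow> U \<in> C \<Longrightarrow> p \<in> I \<Longrightarrow>
    labc (gms is d U) p = labc U p \<otimes> (if posc U p \<in> set is then d (posc U p) else \<one>)"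
  by (induction "is" arbitrary: U) (auto simp: labc_gm posc_gm image_subset_iff m_assoc)

lemma gm_gms_other:
  "set is \<subseteq> I \<Longrightarrow> range d \<subseteq> G \<Longrightarrow> U \<in> C \<Longrightarrow> k \<in> I \<Longrightarrow> a \<in> G \<Longrightarrow> k \<notin> set is \<Longrightarrow>
    gm k a (gms is d U) = gms is d (gm k a U)"
  by (induction "is" arbitrary: U) (auto simp: image_subset_iff gm_comm)

lemma gms_cong: "(\<And>i. i \<in> set is \<Longrightarrow> d i = d' i) \<Longrightarrow> gms is d U = gms is d' U"
  by (induction "is" arbitrary: U) auto

lemma gms_cong_free:
  "set is \<subseteq> I \<Longrightarrow> range d \<subseteq> G \<Longrightarrow> range d' \<subseteq> G \<Longrightarrow> U \<in> C \<Longrightarrow>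
    (\<And>i. i \<in> I \<Longrightarrow> \<not> free i U \<Longrightarrow> d i = d' i) \<Longrightarrow> gms is d U = gms is d' U"
proof (induction "is" arbitrary: U)
  case (Cons i "is")
  have "gm i (d i) U = gm i (d' i) U" using Cons.prems by (cases "free i U") auto
  moreover have "gms is d (gm i (d i) U) = gms is d' (gm i (d i) U)"
    using Cons.prems by (intro Cons.IH) (auto simp: image_subset_iff)
  ultimately show ?case by simp
qed simp

lemma gms_one: "set is \<subseteq> I \<Longrightarrow> U \<in> C \<Longrightarrow> gms is (\<lambda>_. \<one>) U = U"
  by (induction "is" arbitrary: U) (auto simp: gm_one)

lemma gm_gms:
  "set is \<subseteq> I \<Longrightarrow> distinct is \<Longrightarrow> range d \<subseteq> G \<Longrightarrow> U \<in> C \<Longrightarrow> k \<in> set is \<Longrightarrow> a \<in> G \<Longrightarrow>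
    gm k a (gms is d U) = gms is (d(k := d k \<otimes> a)) U"
proof (induction "is" arbitrary: U)
  case (Cons i "is")
  show ?case
  proof (cases "i = k")
    case True
    then have "gm k a (gms is d (gm k (d k) U)) = gms is d (gm k a (gm k (d k) U))"
      using Cons.prems by (intro gm_gms_other) (auto simp: image_subset_iff)
    also have "\<dots> = gms is d (gm k (d k \<otimes> a) U)"
      using Cons.prems True by (simp add: gm_gm image_subset_iff)
    also have "\<dots> = gms is (d(k := d k \<otimes> a)) (gm k (d k \<otimes> a) U)"
      using Cons.prems True by (intro gms_cong) auto
    finally show ?thesis using True by (simp add: fun_upd_def)
  next
    case False
    then have "gm k a (gms is d (gm i (d i) U)) = gms is (d(k := d k \<otimes> a)) (gm i (d i) U)"
      using Cons.prems by (intro Cons.IH) (auto simp: image_subset_iff)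
    then show ?thesis using False by (simp add: fun_upd_def)
  qed
qed simp

text \<open>Lets a scalar be pulled back to the position its token had before the transpositions, so
  that all scalars can be collected first.\<close>

lemma gm_sws:
  "ps \<in> lists (pairs I) \<Longrightarrow> U \<in> C \<Longrightarrow> k \<in> I \<Longrightarrow> a \<in> G \<Longrightarrow> gm (perm ps k) a (sws ps U) = sws ps (gm k a U)"
proof (induction ps arbitrary: U k)
  case (Cons t ps)
  obtain i j where t: "t = (i, j)" "i \<in> I" "j \<in> I" "i \<noteq> j" using Cons.prems(1) by (cases t) auto
  have "transpose i j k \<in> I" using t Cons.prems by (auto simp: transpose_def)
  then have "gm (perm ps (transpose i j k)) a (sws ps (sw i j U)) = sws ps (gm (transpose i j k) a (sw i j U))"
    using Cons.prems t by (intro Cons.IH) auto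
  then show ?case using Cons.prems t by (simp add: sw_gm)
qed simp

definition points :: "nat list" where "points = [1..<Suc n]"

lemma set_points [simp]: "set points = I"
  by (auto simp: points_def I_def)

lemma distinct_points [simp]: "distinct points"
  by (simp add: points_def)

lemma foldl_act_cls: "w \<in> lists X \<Longrightarrow> x \<in> lists X \<Longrightarrow> foldl (\<star>) (cls w) x = cls (w @ x)"
  by (induction x arbitrary: w) (auto simp: cls_act)

lemma foldl_act_C: "U \<in> C \<Longrightarrow> u \<in> lists X1 \<Longrightarrow> foldl (\<star>) U u \<in> C"
proof (induction u arbitrary: U)
  case (Cons x u)
  then show ?case by (cases x) auto
qed simp

lemma posc_foldl_act: "U \<in> C \<Longrightarrow> u \<in> lists X1 \<Longrightarrow> posc (foldl (\<star>) U u) p = pos u (posc U p)"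
proof (induction u arbitrary: U)
  case (Cons x u)
  then show ?case by (cases x) auto
qed simp

section \<open>Comparing words over \<open>X1\<close>\<close>

text \<open>Each letter meets one of three situations: it empties a hole and is inert, it fills a
  hole and is a transposition with a scalar, or it merges two occupied positions, which injectivity
  forbids.\<close>

lemma injective_word_decomp:
  assumes "U \<in> C" "u \<in> lists X1" "inj_on (pos u) (posc U ` I)"
  shows "\<exists>ps\<in>lists (pairs I). \<exists>d. range d \<subseteq> G \<and> foldl (\<star>) U u = sws ps (gms points d U)"
  using assms(2,3)
proof (induction u rule: rev_induct)
  case Nil
  have "range (\<lambda>_::nat. \<one>) \<subseteq> G \<and> foldl (\<star>) U [] = sws [] (gms points (\<lambda>_. \<one>) U)"
    using assms by (simp add: gms_one)
  then show ?case by (intro bexI[of _ "[]"]) (blast, simp)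
next
  case (snoc x u)
  obtain i j a where x: "x = El i j a" "i \<in> I" "j \<in> I" "i \<noteq> j" "a \<in> G" using snoc.prems by (cases x) auto
  have u: "u \<in> lists X1" using snoc.prems by simp
  have "inj_on (pos u) (posc U ` I)" using snoc.prems(2) by (auto simp: inj_on_def)
  then obtain ps d where ps: "ps \<in> lists (pairs I)" and d: "range d \<subseteq> G"
    and e: "foldl (\<star>) U u = sws ps (gms points d U)"
    using snoc.IH u by blast
  define W where "W = foldl (\<star>) U u"
  have W: "W \<in> C" unfolding W_def using assms u by (intro foldl_act_C)
  have ux: "foldl (\<star>) U (u @ [x]) = W \<star> El i j a" using x by (simp add: W_def)
  consider "free j W" | "free i W" | "\<not> free i W" "\<not> free j W" by blast
  then show ?case
  proof cases
    case 1
    then have "W \<star> El i j a = W" using free_act_same W x by blast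
    then show ?thesis using ps d e ux unfolding W_def by metis
  next
    case 2
    define qs where "qs = ps @ [(i, j)]"
    define k where "k = perm (rev qs) i"
    have qs: "qs \<in> lists (pairs I)" "rev qs \<in> lists (pairs I)" using ps x by (auto simp: qs_def)
    have k: "k \<in> I" "perm qs k = i"
      using perm_in[OF qs(2) x(2)] perm_rev by (simp_all add: k_def)
    have "W \<star> El i j a = gm i a (sw i j W)" using act_eq_gm_sw W x 2 by blast
    also have "\<dots> = gm (perm qs k) a (sws qs (gms points d U))"
      using e k by (simp add: qs_def sws_append W_def)
    also have "\<dots> = sws qs (gm k a (gms points d U))"
      using assms(1) qs(1) k x d by (intro gm_sws) auto
    also have "\<dots> = sws qs (gms points (d(k := d k \<otimes> a)) U)"
      using assms k x d by (simp add: gm_gms)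
    finally have "foldl (\<star>) U (u @ [x]) = sws qs (gms points (d(k := d k \<otimes> a)) U)"
      unfolding ux .
    moreover have "range (d(k := d k \<otimes> a)) \<subseteq> G" using d x by (simp add: image_subset_iff)
    ultimately show ?thesis using qs(1) by blast
  next
    case 3
    then obtain p q where pq: "p \<in> I" "q \<in> I" "posc W p = i" "posc W q = j"
      unfolding free_def by auto
    then have "pos u (posc U p) = i" "pos u (posc U q) = j"
      using posc_foldl_act[OF assms(1) u] by (auto simp: W_def)
    then have "pos (u @ [x]) (posc U p) = pos (u @ [x]) (posc U q)" "posc U p \<noteq> posc U q"
      using x by auto
    then show ?thesis using snoc.prems(2) pq by (auto dest: inj_onD)
  qed
qed

text \<open>A prefix of minimal rank works: any remaining collision could be absorbed into it.\<close>

lemma merging_prefix: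
  assumes u: "u \<in> lists X1" "u \<noteq> []"
  shows "\<exists>e. e \<in> lists X1 \<and> e \<noteq> [] \<and> inj_on (pos u) (pos e ` I) \<and>
    (\<forall>w\<in>lists X1. (\<forall>p\<in>I. pos w p = pos u p \<and> lab w p = lab u p) \<longrightarrow> cls (e @ w) = cls w)"
proof -
  \<comment> \<open>The condition covers every word with the effect of \<open>u\<close>, so that one
    prefix can later serve both words being compared.\<close>
  define P where "P e \<longleftrightarrow> e \<in> lists X1 \<and> e \<noteq> [] \<and>
    (\<forall>w\<in>lists X1. (\<forall>p\<in>I. pos w p = pos u p \<and> lab w p = lab u p) \<longrightarrow> cls (e @ w) = cls w)" for e
  have merge: "\<exists>a\<in>G. \<forall>w\<in>lists X1. (\<forall>p\<in>I. pos w p = pos u p \<and> lab w p = lab u p) \<longrightarrow> cls (El p q a # w) = cls w"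
    if pq: "p \<in> I" "q \<in> I" "p \<noteq> q" "pos u p = pos u q" for p q
  proof -
    define a where "a = lab u q \<otimes> inv (lab u p)"
    have "lab u p \<in> G" "lab u q \<in> G" using u by auto
    then have a: "a \<in> G" "lab u q = a \<otimes> lab u p" by (auto simp: a_def m_assoc)
    have "cls (El p q a # w) = cls w"
      if "w \<in> lists X1" "\<forall>p\<in>I. pos w p = pos u p \<and> lab w p = lab u p" for w
      using that pq a by (intro merge_absorb) auto
    then show ?thesis using a by blast
  qed
  \<comment> \<open>A first collision exists because \<open>u\<close> is nonempty. It gives a
    nonempty prefix to start from, so the class of the prefix has a hole.\<close>
  have "\<not> inj_on (pos u) I"
    using pos_not_surj[OF u] endo_inj_surj[of I "pos u"] pos_I[OF X1_X[OF u(1)]] by auto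
  then obtain p q where pq: "p \<in> I" "q \<in> I" "p \<noteq> q" "pos u p = pos u q" by (auto simp: inj_on_def)
  obtain a where "a \<in> G" "\<forall>w\<in>lists X1. (\<forall>p\<in>I. pos w p = pos u p \<and> lab w p = lab u p) \<longrightarrow> cls (El p q a # w) = cls w"
    using merge[OF pq] by blast
  then have "P [El p q a]" using pq by (simp add: P_def)
  then obtain e where e: "P e" and least: "\<And>e'. P e' \<Longrightarrow> card (pos e ` I) \<le> card (pos e' ` I)"
    using ex_has_least_nat[of P _ "\<lambda>e. card (pos e ` I)"] by blast
  have "inj_on (pos u) (pos e ` I)"
  proof (rule ccontr)
    assume "\<not> ?thesis"
    then obtain p q where pq: "p \<in> pos e ` I" "q \<in> pos e ` I" "p \<noteq> q" "pos u p = pos u q"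
      by (auto simp: inj_on_def)
    have eX: "e \<in> lists X" using e X1_X by (simp add: P_def)
    have pqI: "p \<in> I" "q \<in> I" using pq pos_I[OF eX] by auto
    obtain a where a: "a \<in> G" "\<forall>w\<in>lists X1. (\<forall>p\<in>I. pos w p = pos u p \<and> lab w p = lab u p) \<longrightarrow> cls (El p q a # w) = cls w"
      using merge[OF pqI pq(3,4)] by blast
    \<comment> \<open>Appending this merge keeps the absorption property and removes
      \<open>q\<close> from the occupied positions, contradicting minimal rank.\<close>
    have "P (e @ [El p q a])"
      unfolding P_def
    proof (intro conjI ballI impI)
      fix w assume w: "w \<in> lists X1" "\<forall>p\<in>I. pos w p = pos u p \<and> lab w p = lab u p"
      have wX: "w \<in> lists X" "El p q a # w \<in> lists X" using X1_X[OF w(1)] pqI pq a by auto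
      have "El p q a # w \<approx> w" using a(2) w wX cls_eq_iff by blast
      then have "e @ El p q a # w \<approx> e @ w" using eX by (intro eqv_append eqv_refl)
      then have "cls ((e @ [El p q a]) @ w) = cls (e @ w)" using cls_eqI by simp
      then show "cls ((e @ [El p q a]) @ w) = cls w" using e w by (simp add: P_def)
    qed (use e pqI pq a in \<open>auto simp: P_def\<close>)
    then have "card (pos e ` I) \<le> card (pos (e @ [El p q a]) ` I)" by (rule least)
    also have "pos (e @ [El p q a]) ` I \<subseteq> pos e ` I - {q}" using pq by auto
    then have "card (pos (e @ [El p q a]) ` I) \<le> card (pos e ` I - {q})" by (intro card_mono) auto
    also have "\<dots> < card (pos e ` I)" using pq by (intro psubset_card_mono) auto
    finally show False by simp
  qed
  then show ?thesis using e unfolding P_def by blast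
qed

text \<open>Behind a common merging prefix both words become scalars followed by transpositions.
  Cancelling the unit labels of the prefix shows that the scalars agree at the occupied positions;
  so do the permutations, and holes do not matter.\<close>

lemma X1_words_eqv:
  assumes u: "u \<in> lists X1" "u \<noteq> []" and v: "v \<in> lists X1" "v \<noteq> []"
    and eq: "\<And>p. p \<in> I \<Longrightarrow> pos u p = pos v p" "\<And>p. p \<in> I \<Longrightarrow> lab u p = lab v p"
  shows "u \<approx> v"
proof -
  obtain e where e: "e \<in> lists X1" "e \<noteq> []" "inj_on (pos u) (pos e ` I)"
    and abs: "\<forall>w\<in>lists X1. (\<forall>p\<in>I. pos w p = pos u p \<and> lab w p = lab u p) \<longrightarrow> cls (e @ w) = cls w"
    using merging_prefix[OF u] by blast
  define U where "U = cls e"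
  have U: "U \<in> C" using e by (simp add: U_def cls_C)
  have nX: "e \<in> lists X" "u \<in> lists X" "v \<in> lists X" using e u v X1_X by blast+
  have Upos: "posc U = pos e" using nX by (simp add: U_def posc_cls)
  have decomp: "\<exists>ps\<in>lists (pairs I). \<exists>d. range d \<subseteq> G \<and> cls w = sws ps (gms points d U)"
    if w: "w \<in> lists X1" "\<forall>p\<in>I. pos w p = pos u p \<and> lab w p = lab u p" for w
  proof -
    have "cls w = foldl (\<star>) U w"
      using abs w nX X1_X[OF w(1)] by (simp add: U_def foldl_act_cls)
    moreover have "inj_on (pos w) (posc U ` I)"
      using e(3) w(2) pos_I[OF nX(1)] unfolding Upos by (simp add: inj_on_def)
    ultimately show ?thesis using injective_word_decomp[OF U w(1)] by simp
  qed
  obtain ps d where ps: "ps \<in> lists (pairs I)" "range d \<subseteq> G" "cls u = sws ps (gms points d U)"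
    using decomp[OF u(1)] by blast
  obtain qs d' where qs: "qs \<in> lists (pairs I)" "range d' \<subseteq> G" "cls v = sws qs (gms points d' U)"
    using decomp[OF v(1)] eq by auto
  have tok: "pos w p = perm rs (posc U p)" "lab w p = labc U p \<otimes> c (posc U p)"
    if "w \<in> lists X" "rs \<in> lists (pairs I)" "range c \<subseteq> G" "cls w = sws rs (gms points c U)" "p \<in> I" for w rs c p
  proof -
    have V: "gms points c U \<in> C" using that U by simp
    have "pos w p = posc (sws rs (gms points c U)) p" "lab w p = labc (sws rs (gms points c U)) p"
      using posc_cls[OF that(1)] labc_cls[OF that(1)] that(4) by simp_all
    then show "pos w p = perm rs (posc U p)" "lab w p = labc U p \<otimes> c (posc U p)"
      using posc_sws[OF that(2) V that(5)] labc_sws[OF that(2) V that(5)] U that(3,5) posc_I[OF C_C0[OF U] that(5)]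
      by (simp_all add: labc_gms)
  qed
  have dd: "d t = d' t" if t: "t \<in> I" "\<not> free t U" for t
  proof -
    obtain p where p: "p \<in> I" "t = posc U p" using t unfolding free_def by auto
    then have "labc U p \<otimes> d t = labc U p \<otimes> d' t"
      using tok(2)[OF nX(2) ps p(1)] tok(2)[OF nX(3) qs p(1)] eq by simp
    moreover have "labc U p \<in> G" "d t \<in> carrier M" "d' t \<in> carrier M"
      using U ps(2) qs(2) by (auto simp: image_subset_iff)
    ultimately show ?thesis by (simp add: Units_l_cancel)
  qed
  have pp: "perm ps t = perm qs t" if t: "t \<in> I" "\<not> free t U" for t
  proof -
    obtain p where p: "p \<in> I" "t = posc U p" using t unfolding free_def by auto
    then show ?thesis using tok(1)[OF nX(2) ps p(1)] tok(1)[OF nX(3) qs p(1)] eq by simp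
  qed
  have "gms points d U = gms points d' U" using U ps qs dd by (intro gms_cong_free) auto
  moreover have "sws ps (gms points d U) = sws qs (gms points d U)"
    using U ps qs pp by (intro sws_eqI) auto
  ultimately have "cls u = cls v" using ps qs by simp
  then show ?thesis using cls_eq_iff nX by blast
qed

section \<open>Singular maps with unit labels\<close>

lemma permutes_perm:
  assumes "\<pi> permutes I"
  shows "\<exists>ps\<in>lists (pairs I). \<forall>p. perm ps p = \<pi> p"
  using assms finite_I
proof (induction rule: permutes_induct)
  case id
  show ?case by (intro bexI[of _ "[]"]) auto
next
  case (swap a b \<pi>)
  then obtain ps where ps: "ps \<in> lists (pairs I)" "\<forall>p. perm ps p = \<pi> p" by blast
  then show ?case using swap by (intro bexI[of _ "ps @ [(a, b)]"]) (auto simp: perm_append)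
qed

text \<open>Induction on the number of points missed by \<open>\<alpha>\<close>. One point of a
  colliding pair is redirected to a missed value, and a leading merge restores the
  collision.\<close>

lemma unit_maps_reach:
  assumes \<alpha>: "\<alpha> ` I \<subseteq> I" "\<not> inj_on \<alpha> I" and g: "range g \<subseteq> G"
  shows "\<exists>x\<in>lists X1. x \<noteq> [] \<and> (\<forall>p\<in>I. pos x p = \<alpha> p \<and> lab x p = g p)"
  using assms
proof (induction "n - card (\<alpha> ` I)" arbitrary: \<alpha> g rule: less_induct)
  case less
  obtain p q where pq: "p \<in> I" "q \<in> I" "p \<noteq> q" "\<alpha> p = \<alpha> q" using less.prems by (auto simp: inj_on_def)
  have "card (\<alpha> ` I) < card I"
    using less.prems card_image_le[of I \<alpha>] eq_card_imp_inj_on[of I \<alpha>] by fastforce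
  moreover have cI: "card I = n" by (simp add: I_def)
  ultimately have "\<alpha> ` I \<noteq> I" by auto
  then obtain k where k: "k \<in> I" "k \<notin> \<alpha> ` I" using less.prems by blast
  define \<alpha>' where "\<alpha>' = \<alpha>(q := k)"
  have im: "\<alpha>' ` I = insert k (\<alpha> ` I)"
  proof -
    have "I = insert q (I - {q})" using pq by auto
    then have "\<alpha>' ` I = insert k (\<alpha> ` (I - {q}))" unfolding \<alpha>'_def by (auto simp: image_iff)
    moreover have "\<alpha> ` (I - {q}) = \<alpha> ` I"
    proof
      show "\<alpha> ` I \<subseteq> \<alpha> ` (I - {q})"
      proof
        fix z assume "z \<in> \<alpha> ` I"
        then obtain r where "r \<in> I" "z = \<alpha> r" by blast
        then show "z \<in> \<alpha> ` (I - {q})"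
          using pq by (cases "r = q") (auto intro: image_eqI[of _ _ p])
      qed
    qed auto
    ultimately show ?thesis by simp
  qed
  have sub: "\<alpha>' ` I \<subseteq> I" using im k less.prems by simp
  have gG: "g r \<in> G" for r using less.prems by auto
  \<comment> \<open>The leading merge gives token \<open>q\<close> the label \<open>c\<close>, and
    following \<open>p\<close> then contributes \<open>g p\<close>; the product must be
    \<open>g q\<close>.\<close>
  define c where "c = g q \<otimes> inv (g p)"
  have c: "c \<in> G" "c \<otimes> g p = g q" using gG[of p] gG[of q] by (auto simp: c_def m_assoc)
  show ?case
  proof (cases "inj_on \<alpha>' I")
    case True
    define \<pi> where "\<pi> r = (if r \<in> I then \<alpha>' r else r)" for r
    have "\<alpha>' ` I = I" using endo_inj_surj[OF finite_I sub True] .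
    then have "bij_betw \<pi> I I" using True by (simp add: bij_betw_def \<pi>_def inj_on_def)
    then have "\<pi> permutes I" by (rule bij_imp_permutes) (simp add: \<pi>_def)
    then obtain ps where ps: "ps \<in> lists (pairs I)" "\<forall>r. perm ps r = \<pi> r" using permutes_perm by blast
    \<comment> \<open>The redirected map is a permutation, so no word over \<open>X1\<close> has it
      as its effect. After the merge, \<open>q\<close> is a hole, and the permutation and the labels
      are applied virtually; any representative of the resulting class is the desired word.\<close>
    define U where "U = cls [El p q c]"
    have U: "U \<in> C" using pq c by (simp add: U_def cls_C)
    define V where "V = sws ps (gms points g U)"
    have W: "gms points g U \<in> C" using U less.prems by simp
    have V: "V \<in> C" unfolding V_def by (rule sws_C[OF ps(1) W])
    then obtain x where x: "V = cls x" "x \<in> lists X1" "x \<noteq> []" "x \<in> lists X" by (rule C_cases)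
    have "pos x r = \<alpha> r \<and> lab x r = g r" if r: "r \<in> I" for r
    proof -
      have u: "posc U r = (if r = q then p else r)" "labc U r = (if r = q then c else \<one>)"
        using pq c by (auto simp: U_def posc_cls labc_cls)
      have "posc U r \<in> I" using u(1) r pq by simp
      have "pos x r = posc V r" "lab x r = labc V r" using x by (simp_all add: posc_cls labc_cls)
      moreover have "posc V r = \<pi> (posc U r)" "labc V r = labc U r \<otimes> g (posc U r)"
        unfolding V_def posc_sws[OF ps(1) W r] labc_sws[OF ps(1) W r]
        using ps U less.prems r \<open>posc U r \<in> I\<close> by (simp_all add: labc_gms)
      ultimately show ?thesis using u r pq c gG[of r] by (auto simp: \<pi>_def \<alpha>'_def)
    qed
    then show ?thesis using x by blast
  next
    case False
    define g' where "g' = g(q := \<one>)"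
    have g': "range g' \<subseteq> G" using less.prems by (auto simp: g'_def image_subset_iff)
    have "card (\<alpha>' ` I) = Suc (card (\<alpha> ` I))" unfolding im using k by simp
    then have "n - card (\<alpha>' ` I) < n - card (\<alpha> ` I)" using \<open>card (\<alpha> ` I) < card I\<close> cI by simp
    then obtain x where x: "x \<in> lists X1" "\<forall>r\<in>I. pos x r = \<alpha>' r \<and> lab x r = g' r"
      using less.hyps[OF _ sub False g'] by blast
    have "pos (El p q c # x) r = \<alpha> r \<and> lab (El p q c # x) r = g r" if "r \<in> I" for r
      using that x pq c gG[of r] by (auto simp: \<alpha>'_def g'_def)
    moreover have "El p q c # x \<in> lists X1" using x pq c by simp
    ultimately show ?thesis by blast
  qed
qed

section \<open>Words over the copies of \<open>Y\<close>\<close>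

abbreviation YY :: "('y, 'a) letter set" where "YY \<equiv> Y_letters n Y"

lemma YY_X: "w \<in> lists YY \<Longrightarrow> w \<in> lists X"
  by (auto simp: X_def)

lemma copy_append: "copy_word i (u @ v) = copy_word i u @ copy_word i v"
  by (simp add: copy_word_def)

lemma copy_eqv:
  assumes "i \<in> I" "u \<in> lists Y" "v \<in> lists Y" "\<psi> u = \<psi> v"
  shows "copy_word i u \<approx> copy_word i v"
proof -
  have "(u, v) \<in> word_congruence Y Q" using assms psi_eq_iff by blast
  then show ?thesis
  proof (induction rule: word_congruence.induct)
    case (base u v)
    then show ?case unfolding eqv_def
      by (intro word_congruence.base) (use assms(1) in \<open>auto simp: Q_rels_def I_def\<close>)
  next
    case (refl w)
    then show ?case using copy_in_X assms by (intro eqv_refl) simp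
  next
    case (sym u v)
    then show ?case by (blast intro: eqv_sym)
  next
    case (trans u v w)
    then show ?case by (blast intro: eqv_trans)
  next
    case (mult u v u' v')
    then show ?case unfolding copy_append by (intro eqv_append)
  qed
qed

primrec proj :: "nat \<Rightarrow> ('y, 'a) letter list \<Rightarrow> 'y list" where
  "proj i [] = []"
| "proj i (x # w) = (case x of Yl k y \<Rightarrow> (if k = i then y # proj i w else proj i w) | El _ _ _ \<Rightarrow> proj i w)"

lemma proj_append [simp]: "proj i (u @ v) = proj i u @ proj i v"
  by (induction u) (auto split: letter.splits)

lemma proj_copy [simp]: "proj k (copy_word i w) = (if k = i then w else [])"
  by (induction w) (auto simp: copy_word_def)

lemma proj_Y: "w \<in> lists YY \<Longrightarrow> proj i w \<in> lists Y"
proof (induction w)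
  case (Cons x w)
  then show ?case by (cases x) auto
qed simp

lemma pos_YY: "w \<in> lists YY \<Longrightarrow> pos w p = p"
proof (induction w)
  case (Cons x w)
  then show ?case by (cases x) auto
qed simp

lemma lab_YY: "w \<in> lists YY \<Longrightarrow> lab w p = \<psi> (proj p w)"
proof (induction w)
  case (Cons x w)
  then show ?case using psi_hom[of "[_]" "proj p w"] proj_Y[of w p] by (cases x) auto
qed simp

text \<open>The normal form for words over the copies of \<open>Y\<close>: the copies are sorted by
  index.\<close>

definition cprod :: "(nat \<Rightarrow> 'y list) \<Rightarrow> nat list \<Rightarrow> ('y, 'a) letter list"
  where "cprod ws is = concat (map (\<lambda>i. copy_word i (ws i)) is)"

lemma cprod_simps [simp]: "cprod ws [] = []" "cprod ws (i # is) = copy_word i (ws i) @ cprod ws is"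
  by (simp_all add: cprod_def)

lemma cprod_YY: "set is \<subseteq> I \<Longrightarrow> (\<And>i. i \<in> set is \<Longrightarrow> ws i \<in> lists Y) \<Longrightarrow> cprod ws is \<in> lists YY"
proof (induction "is")
  case (Cons i "is")
  then show ?case using copy_in_Y[of i "ws i"] by simp
qed simp

lemma proj_cprod: "distinct is \<Longrightarrow> proj k (cprod ws is) = (if k \<in> set is then ws k else [])"
  by (induction "is") auto

lemma cprod_cong: "(\<And>i. i \<in> set is \<Longrightarrow> ws i = ws' i) \<Longrightarrow> cprod ws is = cprod ws' is"
  by (induction "is") auto

lemma cprod_eqv:
  "set is \<subseteq> I \<Longrightarrow> (\<And>i. i \<in> set is \<Longrightarrow> copy_word i (ws i) \<approx> copy_word i (ws' i)) \<Longrightarrow> cprod ws is \<approx> cprod ws' is"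
  by (induction "is") (auto intro!: eqv_append eqv_refl)

lemma Yl_commute_copy:
  assumes "i \<in> I" "k \<in> I" "i \<noteq> k" "y \<in> Y" "w \<in> lists Y"
  shows "Yl k y # copy_word i w \<approx> copy_word i w @ [Yl k y]"
  using assms(5)
proof (induction w rule: list.induct)
  case Nil
  then show ?case using assms by (auto simp: copy_word_def intro: eqv_refl)
next
  case (Cons x w)
  have "[Yl k y, Yl i x] \<approx> [Yl i x, Yl k y]"
    unfolding eqv_def using assms Cons.prems
    by (intro word_congruence.base) (auto simp: R_comm_def I_def)
  moreover have "copy_word i w \<in> lists X" using assms Cons.prems copy_in_X by simp
  ultimately have "[Yl k y, Yl i x] @ copy_word i w \<approx> [Yl i x, Yl k y] @ copy_word i w"
    by (intro eqv_append eqv_refl)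
  also have "[Yl i x, Yl k y] @ copy_word i w = [Yl i x] @ (Yl k y # copy_word i w)" by simp
  also have "\<dots> \<approx> [Yl i x] @ (copy_word i w @ [Yl k y])"
    using Cons assms by (intro eqv_append eqv_refl) auto
  finally show ?case by (simp add: copy_word_def)
qed

lemma Yl_cprod:
  assumes "k \<in> I" "y \<in> Y"
  shows "set is \<subseteq> I \<Longrightarrow> distinct is \<Longrightarrow> k \<in> set is \<Longrightarrow> (\<And>i. ws i \<in> lists Y) \<Longrightarrow>
    Yl k y # cprod ws is \<approx> cprod (ws(k := y # ws k)) is"
proof (induction "is")
  case (Cons i "is")
  have c: "cprod ws is \<in> lists X" using Cons.prems by (intro YY_X cprod_YY) auto
  have cp: "copy_word i (ws i) \<in> lists X" using Cons.prems by (intro copy_in_X) auto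
  show ?case
  proof (cases "i = k")
    case True
    have "cprod (ws(k := y # ws k)) is = cprod ws is"
      using Cons.prems True by (intro cprod_cong) auto
    then show ?thesis using True assms c cp by (auto simp: copy_word_def fun_upd_def intro!: eqv_refl)
  next
    case False
    have "(Yl k y # copy_word i (ws i)) @ cprod ws is \<approx> (copy_word i (ws i) @ [Yl k y]) @ cprod ws is"
      using Cons.prems False assms c by (intro eqv_append eqv_refl Yl_commute_copy) auto
    also have "(copy_word i (ws i) @ [Yl k y]) @ cprod ws is = copy_word i (ws i) @ (Yl k y # cprod ws is)"
      by simp
    also have "\<dots> \<approx> copy_word i (ws i) @ cprod (ws(k := y # ws k)) is"
      using Cons False cp by (intro eqv_append eqv_refl) (auto simp: fun_upd_def)
    finally show ?thesis using False by (simp add: fun_upd_def)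
  qed
qed simp

lemma YY_eqv_cprod: "w \<in> lists YY \<Longrightarrow> w \<approx> cprod (\<lambda>i. proj i w) points"
proof (induction w)
  case Nil
  have "cprod (\<lambda>i. []) is = []" for "is" by (induction "is") (auto simp: copy_word_def)
  then show ?case by (auto intro: eqv_refl)
next
  case (Cons x w)
  then obtain k y where x: "x = Yl k y" "k \<in> I" "y \<in> Y" by (cases x) auto
  have w: "w \<in> lists YY" using Cons.prems by simp
  have "[x] @ w \<approx> [x] @ cprod (\<lambda>i. proj i w) points"
    using Cons x by (intro eqv_append eqv_refl) auto
  also have "Yl k y # cprod (\<lambda>i. proj i w) points \<approx> cprod ((\<lambda>i. proj i w)(k := y # proj k w)) points"
    using x proj_Y[OF w] by (intro Yl_cprod) auto
  then have "[x] @ cprod (\<lambda>i. proj i w) points \<approx> cprod ((\<lambda>i. proj i w)(k := y # proj k w)) points"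
    using x by simp
  also have "cprod ((\<lambda>i. proj i w)(k := y # proj k w)) points = cprod (\<lambda>i. proj i (x # w)) points"
    using x by (intro cprod_cong) auto
  finally show ?case by simp
qed

lemma YY_eqvI:
  assumes "u \<in> lists YY" "v \<in> lists YY" "\<And>i. i \<in> I \<Longrightarrow> \<psi> (proj i u) = \<psi> (proj i v)"
  shows "u \<approx> v"
proof -
  have "cprod (\<lambda>i. proj i u) points \<approx> cprod (\<lambda>i. proj i v) points"
    using assms proj_Y by (intro cprod_eqv copy_eqv) auto
  then have "u \<approx> cprod (\<lambda>i. proj i v) points"
    by (rule eqv_trans[OF YY_eqv_cprod[OF assms(1)]])
  then show ?thesis
    by (rule eqv_trans[OF _ eqv_sym[OF YY_eqv_cprod[OF assms(2)]]])
qed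

section \<open>Moving the letters of \<open>Y\<close> to the left\<close>

text \<open>The indices \<open>i\<close> and \<open>j\<close> survive and only the unit may change,
  so the letter can be moved past a whole word by induction.\<close>

lemma El_past_Yl:
  assumes "i \<in> I" "j \<in> I" "i \<noteq> j" "a \<in> G" "k \<in> I" "y \<in> Y"
  shows "\<exists>w\<in>lists YY. \<exists>b\<in>G. [El i j a, Yl k y] \<approx> w @ [El i j b]"
proof -
  have di: "distinct_indices n [i, j]" using assms by (simp add: distinct_indices_iff)
  consider "k = i" | "k = j" | "k \<noteq> i" "k \<noteq> j" by blast
  then show ?thesis
  proof cases
    case 1
    have "a \<otimes> \<psi> [y] \<in> carrier M - G" using assms nonunit_mult_left psi_nonunit_letter by blast
    then have "copy_word j (h (a \<otimes> \<psi> [y])) \<in> lists YY" using h_nonunit assms by (intro copy_in_Y) auto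
    then show ?thesis
      using R_nabla_eqv[OF R_nabla.intros(1)[OF assms(6) di assms(4)]] 1 assms
      by (intro bexI[of _ "[Yl i y] @ copy_word j (h (a \<otimes> \<psi> [y]))"] bexI[of _ \<one>]) auto
  next
    case 2
    then show ?thesis
      using R_nabla_eqv[OF R_nabla.intros(2)[OF assms(6) di assms(4)]] assms
      by (intro bexI[of _ "[]"] bexI[of _ a]) auto
  next
    case 3
    then have "([El i j a, Yl k y], [Yl k y, El i j a]) \<in> R_nabla M n Y \<psi> h"
      using assms di by (intro R_nabla.intros(3)) (auto simp: I_def)
    then show ?thesis
      using R_nabla_eqv assms by (intro bexI[of _ "[Yl k y]"] bexI[of _ a]) auto
  qed
qed

lemma El_past_YY:
  assumes "w \<in> lists YY" "i \<in> I" "j \<in> I" "i \<noteq> j" "a \<in> G"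
  shows "\<exists>w'\<in>lists YY. \<exists>b\<in>G. El i j a # w \<approx> w' @ [El i j b]"
  using assms(1,5)
proof (induction w arbitrary: a rule: list.induct)
  case Nil
  then show ?case using assms by (intro bexI[of _ "[]"] bexI[of _ a]) (auto intro: eqv_refl)
next
  case (Cons x w)
  then obtain k y where x: "x = Yl k y" "k \<in> I" "y \<in> Y" by (cases x) auto
  obtain w1 b where 1: "w1 \<in> lists YY" "b \<in> G" "[El i j a, x] \<approx> w1 @ [El i j b]"
    using El_past_Yl[of i j a k y] assms Cons.prems x by auto
  obtain w2 c where 2: "w2 \<in> lists YY" "c \<in> G" "El i j b # w \<approx> w2 @ [El i j c]"
    using Cons.IH[of b] Cons.prems 1 by auto
  have wX: "w \<in> lists X" using Cons.prems YY_X by simp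
  have "[El i j a, x] @ w \<approx> (w1 @ [El i j b]) @ w"
    by (intro eqv_append eqv_refl 1 wX)
  also have "(w1 @ [El i j b]) @ w = w1 @ (El i j b # w)" by simp
  also have "\<dots> \<approx> w1 @ (w2 @ [El i j c])"
    by (intro eqv_append eqv_refl 2 YY_X 1)
  finally show ?case using 1 2 by (intro bexI[of _ "w1 @ w2"] bexI[of _ c]) auto
qed

lemma word_split:
  "w \<in> lists X \<Longrightarrow> \<exists>y\<in>lists YY. \<exists>x\<in>lists X1. w \<approx> y @ x"
proof (induction w rule: list.induct)
  case Nil
  show ?case by (intro bexI[of _ "[]"]) (auto intro: eqv_refl)
next
  case (Cons z w)
  then obtain y x where yx: "y \<in> lists YY" "x \<in> lists X1" "w \<approx> y @ x" by auto
  have zX: "[z] \<in> lists X" using Cons.prems by simp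
  have zw: "[z] @ w \<approx> [z] @ (y @ x)" by (intro eqv_append eqv_refl zX yx)
  show ?case
  proof (cases z)
    case (Yl k b)
    then show ?thesis using zw yx Cons.prems by (intro bexI[of _ "z # y"] bexI[OF _ yx(2)]) auto
  next
    case (El i j a)
    then obtain y' b where y': "y' \<in> lists YY" "b \<in> G" "z # y \<approx> y' @ [El i j b]"
      using El_past_YY[OF yx(1), of i j a] Cons.prems by auto
    have "(z # y) @ x \<approx> (y' @ [El i j b]) @ x"
      by (intro eqv_append eqv_refl y' X1_X yx)
    then have "z # w \<approx> y' @ (El i j b # x)" using zw eqv_trans[of "z # w" "z # y @ x"] by simp
    then show ?thesis using y' yx El Cons.prems by (intro bexI[OF _ y'(1)] bexI[of _ "El i j b # x"]) auto
  qed
qed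

section \<open>Absorbing unit labels\<close>

lemma El_commute_copy:
  assumes "p \<in> I" "q \<in> I" "p \<noteq> q" "c \<in> G" "i \<in> I" "i \<noteq> p" "i \<noteq> q" "w \<in> lists Y"
  shows "El p q c # copy_word i w \<approx> copy_word i w @ [El p q c]"
  using assms(8)
proof (induction w rule: list.induct)
  case Nil
  then show ?case using assms by (auto simp: copy_word_def intro: eqv_refl)
next
  case (Cons x w)
  have "[El p q c, Yl i x] \<approx> [Yl i x, El p q c]"
    using assms Cons.prems by (intro R_nabla_eqv R_nabla.intros(3)) (auto simp: I_def distinct_indices_iff)
  moreover have "copy_word i w \<in> lists X" using assms Cons.prems copy_in_X by simp
  ultimately have "[El p q c, Yl i x] @ copy_word i w \<approx> [Yl i x, El p q c] @ copy_word i w"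
    by (intro eqv_append eqv_refl)
  also have "[Yl i x, El p q c] @ copy_word i w = [Yl i x] @ (El p q c # copy_word i w)" by simp
  also have "\<dots> \<approx> [Yl i x] @ (copy_word i w @ [El p q c])"
    using Cons assms by (intro eqv_append eqv_refl) auto
  finally show ?case by (simp add: copy_word_def)
qed

lemma pos_not_inj: "x \<in> lists X1 \<Longrightarrow> x \<noteq> [] \<Longrightarrow> \<not> inj_on (pos x) I"
  using pos_not_surj[of x] endo_inj_surj[of I "pos x"] pos_I[OF X1_X[of x]] by auto

text \<open>The word \<open>x\<close> is rewritten, by completeness for \<open>X1\<close>, so that
  token \<open>i\<close> first makes a round trip carrying its unit; the last relation of
  \<open>R_nabla\<close> then takes that unit into the letter. Let \<open>z\<close> be a word with
  the effect of \<open>x\<close> but label 1 at \<open>i\<close>.\<close>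

lemma absorb_letter:
  assumes y: "y \<in> Y" and i: "i \<in> I" and x: "x \<in> lists X1" "x \<noteq> []"
  shows "\<exists>w\<in>lists Y. \<exists>x'\<in>lists X1. Yl i y # x \<approx> copy_word i w @ x' \<and> x' \<noteq> [] \<and> lab x' i = \<one> \<and>
    (\<forall>p\<in>I. p \<noteq> i \<longrightarrow> lab x' p = lab x p)"
proof -
  have xX: "x \<in> lists X" using x X1_X by blast
  have G: "lab x p \<in> G" for p using x by simp
  have "range ((lab x)(i := \<one>)) \<subseteq> G" using G by (auto simp: image_subset_iff)
  then obtain z where z: "z \<in> lists X1" "z \<noteq> []"
    and zp: "\<And>p. p \<in> I \<Longrightarrow> pos z p = pos x p" "\<And>p. p \<in> I \<Longrightarrow> lab z p = (if p = i then \<one> else lab x p)"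
    using unit_maps_reach[of "pos x" "(lab x)(i := \<one>)"] pos_I[OF xX] pos_not_inj[OF x] by fastforce
  have zX: "z \<in> lists X" using z X1_X by blast
  have nu: "\<psi> [y] \<otimes> a \<otimes> b \<in> carrier M - G" if "a \<in> G" "b \<in> G" for a b
    using that y nonunit_mult_right psi_nonunit_letter by blast
  have yX: "[Yl i y] \<in> lists X" using y i by simp
  show ?thesis
  proof (cases "\<exists>j\<in>I. j \<noteq> i \<and> pos x j = pos x i")
    case True
    then obtain j where j: "j \<in> I" "j \<noteq> i" "pos x j = pos x i" by blast
    \<comment> \<open>Token \<open>i\<close> joins \<open>j\<close> with label \<open>a\<close>,
      then both move to \<open>i\<close> with label \<open>b\<close>. They end with
      \<open>a \<otimes> b\<close> and \<open>b\<close>, which must be their labels under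
      \<open>x\<close>.\<close>
    define a where "a = lab x i \<otimes> inv (lab x j)"
    define b where "b = lab x j"
    have ab: "a \<in> G" "b \<in> G" "a \<otimes> b = lab x i" using G[of i] G[of j] by (auto simp: a_def b_def m_assoc)
    define w where "w = h (\<psi> [y] \<otimes> a \<otimes> b)"
    have w: "w \<in> lists Y" unfolding w_def using nu[OF ab(1,2)] h_nonunit by blast
    have "x \<approx> El j i a # El i j b # z"
    proof (rule X1_words_eqv)
      show "El j i a # El i j b # z \<in> lists X1" using z i j ab by simp
      show "pos x p = pos (El j i a # El i j b # z) p" if "p \<in> I" for p
        using that zp j i by auto
      show "lab x p = lab (El j i a # El i j b # z) p" if "p \<in> I" for p
        using that zp j i ab G[of p] by (auto simp: b_def)
    qed (use x in auto)
    then have "[Yl i y] @ x \<approx> [Yl i y] @ (El j i a # El i j b # z)"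
      by (intro eqv_append eqv_refl yX)
    also have "[Yl i y] @ (El j i a # El i j b # z) = [Yl i y, El j i a, El i j b] @ z" by simp
    also have "\<dots> \<approx> (copy_word i w @ [El i j b]) @ z"
      unfolding w_def using y i j ab
      by (intro eqv_append eqv_refl zX R_nabla_eqv R_nabla.intros(5)) (auto simp: distinct_indices_iff)
    finally have "Yl i y # x \<approx> copy_word i w @ (El i j b # z)" by simp
    moreover have "lab (El i j b # z) i = \<one>" using j i zp(2)[of i] by simp
    moreover have "\<forall>p\<in>I. p \<noteq> i \<longrightarrow> lab (El i j b # z) p = lab x p"
      using j i zp G ab by (auto simp: b_def)
    moreover have "El i j b # z \<in> lists X1" using z i j ab by simp
    ultimately show ?thesis using w by blast
  next
    case False
    \<comment> \<open>No other token collides with \<open>i\<close>, so the round trip needs a hole.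
      A collision elsewhere provides one: merging \<open>q\<close> into \<open>p\<close> first
      vacates \<open>q\<close>, and that merge commutes with the copy of index
      \<open>i\<close>.\<close>
    obtain p q where pq: "p \<in> I" "q \<in> I" "p \<noteq> q" "pos x p = pos x q"
      using pos_not_inj[OF x] by (auto simp: inj_on_def)
    have pqi: "p \<noteq> i" "q \<noteq> i" using False pq by metis+
    define c where "c = lab x q \<otimes> inv (lab x p)"
    have c: "c \<in> G" "c \<otimes> lab x p = lab x q" using G[of p] G[of q] by (auto simp: c_def m_assoc)
    define a where "a = lab x i"
    have a: "a \<in> G" using G by (simp add: a_def)
    define w where "w = h (\<psi> [y] \<otimes> a \<otimes> \<one>)"
    have w: "w \<in> lists Y" unfolding w_def using nu[OF a Units_one_closed] h_nonunit by blast
    have cw: "copy_word i w \<in> lists X" using w i by (intro copy_in_X)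
    have "x \<approx> El p q c # El q i a # El i q \<one> # z"
    proof (rule X1_words_eqv)
      show "El p q c # El q i a # El i q \<one> # z \<in> lists X1" using z i pq pqi c a by simp
      show "pos x r = pos (El p q c # El q i a # El i q \<one> # z) r" if "r \<in> I" for r
        using that zp pq pqi i by auto
      show "lab x r = lab (El p q c # El q i a # El i q \<one> # z) r" if "r \<in> I" for r
        using that zp pq pqi i c a G[of r] G[of p] by (auto simp: a_def)
    qed (use x in auto)
    then have "[Yl i y] @ x \<approx> [Yl i y] @ (El p q c # El q i a # El i q \<one> # z)"
      by (intro eqv_append eqv_refl yX)
    also have "[Yl i y] @ (El p q c # El q i a # El i q \<one> # z) = [Yl i y, El p q c] @ (El q i a # El i q \<one> # z)" by simp
    also have "\<dots> \<approx> [El p q c, Yl i y] @ (El q i a # El i q \<one> # z)"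
      using y i pq pqi c a zX
      by (intro eqv_append eqv_refl eqv_sym[OF R_nabla_eqv[OF R_nabla.intros(3)]]) (auto simp: distinct_indices_iff I_def)
    also have "\<dots> = [El p q c] @ [Yl i y, El q i a, El i q \<one>] @ z" by simp
    also have "\<dots> \<approx> [El p q c] @ (copy_word i w @ [El i q \<one>]) @ z"
      unfolding w_def using y i pq pqi c a
      by (intro eqv_append eqv_refl zX R_nabla_eqv R_nabla.intros(5)) (auto simp: distinct_indices_iff)
    also have "\<dots> = (El p q c # copy_word i w) @ (El i q \<one> # z)" by simp
    also have "\<dots> \<approx> (copy_word i w @ [El p q c]) @ (El i q \<one> # z)"
      using pq pqi c i w zX by (intro eqv_append eqv_refl El_commute_copy) auto
    finally have "Yl i y # x \<approx> copy_word i w @ (El p q c # El i q \<one> # z)" by simp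
    moreover have "lab (El p q c # El i q \<one> # z) i = \<one>" using pq pqi i zp(2)[of i] by simp
    moreover have "\<forall>r\<in>I. r \<noteq> i \<longrightarrow> lab (El p q c # El i q \<one> # z) r = lab x r"
    proof (intro ballI impI)
      fix r assume r: "r \<in> I" "r \<noteq> i"
      show "lab (El p q c # El i q \<one> # z) r = lab x r"
        using r pq pqi i zp c G[of r] G[of p] by auto
    qed
    moreover have "El p q c # El i q \<one> # z \<in> lists X1" using z i pq pqi c by simp
    ultimately show ?thesis using w by blast
  qed
qed

text \<open>Only the last letter of the copy with index \<open>i\<close> has to touch
  \<open>x\<close>. Preserving all data at the other indices allows the absorption to be repeated
  index by index.\<close>

lemma absorb_at:
  assumes y: "y \<in> lists YY" and i: "i \<in> I" and x: "x \<in> lists X1" "x \<noteq> []"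
  shows "\<exists>y'\<in>lists YY. \<exists>x'\<in>lists X1. y @ x \<approx> y' @ x' \<and> x' \<noteq> [] \<and> (proj i y' \<noteq> [] \<longrightarrow> lab x' i = \<one>) \<and>
    (\<forall>p\<in>I. p \<noteq> i \<longrightarrow> proj p y' = proj p y \<and> lab x' p = lab x p)"
proof (cases "proj i y = []")
  case True
  have "y @ x \<approx> y @ x" using y x YY_X X1_X by (intro eqv_append eqv_refl) auto
  then show ?thesis using True y x by blast
next
  case False
  then obtain v b where v: "proj i y = v @ [b]" by (metis rev_exhaust)
  have vb: "v \<in> lists Y" "b \<in> Y" using proj_Y[OF y, of i] v by auto
  obtain w x' where w: "w \<in> lists Y" and x': "x' \<in> lists X1" "x' \<noteq> []" "lab x' i = \<one>" "\<forall>p\<in>I. p \<noteq> i \<longrightarrow> lab x' p = lab x p"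
    and e: "Yl i b # x \<approx> copy_word i w @ x'"
    using absorb_letter[OF vb(2) i x] by blast
  define s where "s = cprod (\<lambda>k. if k = i then [] else proj k y) points @ copy_word i v"
  have s: "s \<in> lists YY"
    using proj_Y[OF y] copy_in_Y[OF i vb(1)] cprod_YY[of points] unfolding s_def by auto
  have pj: "proj k s = (if k = i then v else if k \<in> I then proj k y else [])" for k
    by (simp add: s_def proj_cprod)
  have "y \<approx> s @ [Yl i b]"
  proof (rule YY_eqvI)
    show "s @ [Yl i b] \<in> lists YY" using s i vb by simp
    show "\<psi> (proj k y) = \<psi> (proj k (s @ [Yl i b]))" if "k \<in> I" for k
      using that pj v by (cases "k = i") auto
  qed (rule y)
  then have "y @ x \<approx> (s @ [Yl i b]) @ x" using x X1_X by (intro eqv_append eqv_refl) auto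
  also have "(s @ [Yl i b]) @ x = s @ (Yl i b # x)" by simp
  also have "\<dots> \<approx> s @ (copy_word i w @ x')" using s YY_X by (intro eqv_append eqv_refl e) auto
  finally have "y @ x \<approx> (s @ copy_word i w) @ x'" by simp
  moreover have "s @ copy_word i w \<in> lists YY" using s copy_in_Y[OF i w] by simp
  moreover have "\<forall>p\<in>I. p \<noteq> i \<longrightarrow> proj p (s @ copy_word i w) = proj p y \<and> lab x' p = lab x p"
    using pj x' by simp
  ultimately show ?thesis using x' by blast
qed

lemma absorb_all:
  assumes "finite A" "A \<subseteq> I" "y \<in> lists YY" "x \<in> lists X1" "x \<noteq> []"
  shows "\<exists>y'\<in>lists YY. \<exists>x'\<in>lists X1. y @ x \<approx> y' @ x' \<and> x' \<noteq> [] \<and>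
    (\<forall>i\<in>A. proj i y' \<noteq> [] \<longrightarrow> lab x' i = \<one>)"
  using assms(1,2)
proof (induction A rule: finite_induct)
  case empty
  have "y @ x \<approx> y @ x" using assms YY_X X1_X by (intro eqv_append eqv_refl) auto
  then show ?case using assms by blast
next
  case (insert i A)
  then obtain y1 x1 where 1: "y1 \<in> lists YY" "x1 \<in> lists X1" "x1 \<noteq> []" "y @ x \<approx> y1 @ x1"
      "\<forall>i\<in>A. proj i y1 \<noteq> [] \<longrightarrow> lab x1 i = \<one>" by auto
  obtain y2 x2 where 2: "y2 \<in> lists YY" "x2 \<in> lists X1" "x2 \<noteq> []" "y1 @ x1 \<approx> y2 @ x2"
      "proj i y2 \<noteq> [] \<longrightarrow> lab x2 i = \<one>"
      "\<forall>p\<in>I. p \<noteq> i \<longrightarrow> proj p y2 = proj p y1 \<and> lab x2 p = lab x1 p"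
    using absorb_at[OF 1(1) _ 1(2,3), of i] insert.prems by auto
  have "y @ x \<approx> y2 @ x2" using 1(4) 2(4) by (rule eqv_trans)
  moreover have "\<forall>k\<in>insert i A. proj k y2 \<noteq> [] \<longrightarrow> lab x2 k = \<one>"
    using 1(5) 2(5,6) insert by (auto simp: subset_iff)
  ultimately show ?case using 2 by blast
qed

lemma normal_form:
  assumes "w \<in> lists X"
  shows "\<exists>y\<in>lists YY. \<exists>x\<in>lists X1. w \<approx> y @ x \<and> (\<forall>i\<in>I. proj i y \<noteq> [] \<longrightarrow> lab x i = \<one>)"
proof -
  obtain y x where yx: "y \<in> lists YY" "x \<in> lists X1" "w \<approx> y @ x" using word_split[OF assms] by blast
  show ?thesis
  proof (cases "x = []")
    case True
    then show ?thesis using yx by (intro bexI[OF _ yx(1)] bexI[OF _ yx(2)]) simp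
  next
    case False
    obtain y' x' where yx': "y' \<in> lists YY" "x' \<in> lists X1" "y @ x \<approx> y' @ x'"
      "\<forall>i\<in>I. proj i y' \<noteq> [] \<longrightarrow> lab x' i = \<one>"
      using absorb_all[OF finite_I subset_refl yx(1,2) False] by blast
    show ?thesis using yx' eqv_trans[OF yx(3) yx'(3)] by blast
  qed
qed

text \<open>In normal form a label is either a unit with an empty \<open>Y\<close> part, or the
  value of a nonempty \<open>Y\<close> part and hence a nonunit. Equal labels therefore fall into
  the same case and determine both factors.\<close>

lemma word_eqvI:
  assumes "w \<in> lists X" "w' \<in> lists X"
    and eq: "\<And>p. p \<in> I \<Longrightarrow> pos w p = pos w' p" "\<And>p. p \<in> I \<Longrightarrow> lab w p = lab w' p"
  shows "w \<approx> w'"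
proof -
  obtain y x where yx: "y \<in> lists YY" "x \<in> lists X1" "w \<approx> y @ x" "\<forall>i\<in>I. proj i y \<noteq> [] \<longrightarrow> lab x i = \<one>"
    using normal_form[OF assms(1)] by blast
  obtain y' x' where yx': "y' \<in> lists YY" "x' \<in> lists X1" "w' \<approx> y' @ x'" "\<forall>i\<in>I. proj i y' \<noteq> [] \<longrightarrow> lab x' i = \<one>"
    using normal_form[OF assms(2)] by blast
  have tok: "pos v p = pos b p" "lab v p = \<psi> (proj p a) \<otimes> lab b p"
    if "a \<in> lists YY" "b \<in> lists X1" "v \<approx> a @ b" for v a b p
    using eqv_pos[OF that(3), of p] eqv_lab[OF that(3), of p] that YY_X X1_X by (simp_all add: pos_YY lab_YY)
  have pos: "pos x p = pos x' p" if "p \<in> I" for p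
    using tok(1)[OF yx(1-3)] tok(1)[OF yx'(1-3)] eq that by metis
  have lab: "\<psi> (proj p y) \<otimes> lab x p = \<psi> (proj p y') \<otimes> lab x' p" if "p \<in> I" for p
    using tok(2)[OF yx(1-3)] tok(2)[OF yx'(1-3)] eq that by metis
  have both: "\<psi> (proj p y) = \<psi> (proj p y') \<and> lab x p = lab x' p" if p: "p \<in> I" for p
  proof -
    have G: "lab x p \<in> G" "lab x' p \<in> G" using yx yx' by auto
    have P: "proj p y \<in> lists Y" "proj p y' \<in> lists Y" using yx yx' proj_Y by auto
    show ?thesis
    proof (cases "proj p y = []"; cases "proj p y' = []")
      assume "proj p y = []" "proj p y' = []"
      then show ?thesis using lab[OF p] G by simp
    next
      assume "proj p y = []" "proj p y' \<noteq> []"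
      then show ?thesis using lab[OF p] G P psi_nonunit[OF P(2)] yx'(4) p by auto
    next
      assume "proj p y \<noteq> []" "proj p y' = []"
      then show ?thesis using lab[OF p] G P psi_nonunit[OF P(1)] yx(4) p by auto
    next
      assume "proj p y \<noteq> []" "proj p y' \<noteq> []"
      then show ?thesis using lab[OF p] P yx(4) yx'(4) p by auto
    qed
  qed
  have "x \<approx> x'"
  proof (cases "x = [] \<or> x' = []")
    case True
    \<comment> \<open>Only the empty word over \<open>X1\<close> acts injectively, so if one of the
      two is empty, both are.\<close>
    have "inj_on (pos x) I \<longleftrightarrow> inj_on (pos x') I" using pos by (intro inj_on_cong) simp
    moreover have "inj_on (pos []) I" by (simp add: inj_on_def)
    ultimately have "x = []" "x' = []" using True pos_not_inj[OF yx(2)] pos_not_inj[OF yx'(2)] by auto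
    then show ?thesis by (auto intro: eqv_refl)
  next
    case False
    then show ?thesis using yx yx' pos both by (intro X1_words_eqv) auto
  qed
  moreover have "y \<approx> y'" using yx yx' both by (intro YY_eqvI) auto
  ultimately have "y @ x \<approx> y' @ x'" by (intro eqv_append)
  then have "w \<approx> y' @ x'" by (rule eqv_trans[OF yx(3)])
  then show ?thesis by (rule eqv_trans[OF _ eqv_sym[OF yx'(3)]])
qed

section \<open>The presentation\<close>

abbreviation T :: "((nat \<Rightarrow> 'a) \<times> (nat \<Rightarrow> nat)) monoid" where "T \<equiv> wreath M n"

lemma wreath_mult: "(a, \<alpha>) \<otimes>\<^bsub>T\<^esub> (b, \<beta>) = (\<lambda>i\<in>I. a i \<otimes> b (\<alpha> i), \<lambda>i\<in>I. \<beta> (\<alpha> i))"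
  by (simp add: wreath_def full_transf_def I_def)

lemma wreath_one: "\<one>\<^bsub>T\<^esub> = (\<lambda>i\<in>I. \<one>, \<lambda>i\<in>I. i)"
  by (simp add: wreath_def full_transf_def I_def)

lemma wreath_carrier: "carrier T = (I \<rightarrow>\<^sub>E carrier M) \<times> (I \<rightarrow>\<^sub>E I)"
  by (simp add: wreath_def full_transf_def I_def)

lemma monoid_wreath: "monoid T"
proof
  fix x y z assume "x \<in> carrier T" "y \<in> carrier T" "z \<in> carrier T"
  then obtain a \<alpha> b \<beta> c \<gamma> where xyz: "x = (a, \<alpha>)" "y = (b, \<beta>)" "z = (c, \<gamma>)"
    and "a \<in> I \<rightarrow>\<^sub>E carrier M" "\<alpha> \<in> I \<rightarrow>\<^sub>E I" "b \<in> I \<rightarrow>\<^sub>E carrier M" "\<beta> \<in> I \<rightarrow>\<^sub>E I"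
      "c \<in> I \<rightarrow>\<^sub>E carrier M" "\<gamma> \<in> I \<rightarrow>\<^sub>E I"
    unfolding wreath_carrier by blast
  then have in_carrier: "i \<in> I \<Longrightarrow> a i \<in> carrier M" "i \<in> I \<Longrightarrow> b i \<in> carrier M" "i \<in> I \<Longrightarrow> c i \<in> carrier M"
    "i \<in> I \<Longrightarrow> \<alpha> i \<in> I" "i \<in> I \<Longrightarrow> \<beta> i \<in> I" for i by auto
  show "x \<otimes>\<^bsub>T\<^esub> y \<otimes>\<^bsub>T\<^esub> z = x \<otimes>\<^bsub>T\<^esub> (y \<otimes>\<^bsub>T\<^esub> z)"
    unfolding xyz wreath_mult using in_carrier
    by (auto simp: m_assoc intro!: restrict_ext)
next
  fix x assume "x \<in> carrier T"
  then obtain a \<alpha> where x: "x = (a, \<alpha>)" and a: "a \<in> I \<rightarrow>\<^sub>E carrier M" and \<alpha>: "\<alpha> \<in> I \<rightarrow>\<^sub>E I"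
    unfolding wreath_carrier by blast
  have "a i \<in> carrier M" "\<alpha> i \<in> I" if "i \<in> I" for i using a \<alpha> that by auto
  moreover have "a i = undefined" "\<alpha> i = undefined" if "i \<notin> I" for i
    using PiE_arb[OF a that] PiE_arb[OF \<alpha> that] by simp_all
  ultimately show "\<one>\<^bsub>T\<^esub> \<otimes>\<^bsub>T\<^esub> x = x" "x \<otimes>\<^bsub>T\<^esub> \<one>\<^bsub>T\<^esub> = x"
    unfolding x wreath_one wreath_mult by (auto simp: fun_eq_iff)
next
  fix x y assume "x \<in> carrier T" "y \<in> carrier T"
  then obtain a \<alpha> b \<beta> where xy: "x = (a, \<alpha>)" "y = (b, \<beta>)"
    and "a \<in> I \<rightarrow>\<^sub>E carrier M" "\<alpha> \<in> I \<rightarrow>\<^sub>E I" "b \<in> I \<rightarrow>\<^sub>E carrier M" "\<beta> \<in> I \<rightarrow>\<^sub>E I"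
    unfolding wreath_carrier by blast
  then have "a i \<in> carrier M" "b i \<in> carrier M" "\<alpha> i \<in> I" "\<beta> i \<in> I" if "i \<in> I" for i
    using that by auto
  then show "x \<otimes>\<^bsub>T\<^esub> y \<in> carrier T" unfolding xy wreath_carrier wreath_mult by auto
qed (auto simp: wreath_carrier wreath_one)

lemma coord_elt_eq: "coord_elt M n i b = (\<lambda>k\<in>I. if k = i then b else \<one>, \<lambda>k\<in>I. k)"
  by (simp add: coord_elt_def coord_tuple_def full_transf_def I_def)

lemma eps_elt_eq: "eps_elt M n i j a = (\<lambda>k\<in>I. if k = j then a else \<one>, \<lambda>k\<in>I. if k = j then i else k)"
  by (simp add: eps_elt_def coord_tuple_def eps_def I_def)

lemma Theta_eq: "w \<in> lists X \<Longrightarrow> Theta M n \<psi> w = (\<lambda>p\<in>I. lab w p, \<lambda>p\<in>I. pos w p)"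
proof (induction w)
  case Nil
  have "Theta M n \<psi> [] = \<one>\<^bsub>T\<^esub>" by (simp add: Theta_def word_hom_def idem_gen_def)
  also have "\<dots> = (\<lambda>p\<in>I. lab [] p, \<lambda>p\<in>I. pos [] p)"
    unfolding wreath_one by (auto intro!: restrict_ext)
  finally show ?case .
next
  case (Cons x w)
  then have x: "x \<in> X" and w: "w \<in> lists X" by auto
  have "Theta_letter M n \<psi> x = (\<lambda>p\<in>I. llab x p, \<lambda>p\<in>I. lpos x p)"
    by (cases x) (simp_all add: coord_elt_eq eps_elt_eq)
  moreover have "Theta M n \<psi> (x # w) = Theta_letter M n \<psi> x \<otimes>\<^bsub>T\<^esub> Theta M n \<psi> w"
    by (simp add: Theta_def word_hom_def idem_gen_def)
  ultimately have "Theta M n \<psi> (x # w) = (\<lambda>p\<in>I. llab x p, \<lambda>p\<in>I. lpos x p) \<otimes>\<^bsub>T\<^esub> (\<lambda>p\<in>I. lab w p, \<lambda>p\<in>I. pos w p)"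
    by (simp only: Cons.IH[OF w])
  also have "\<dots> = (\<lambda>p\<in>I. lab (x # w) p, \<lambda>p\<in>I. pos (x # w) p)"
    unfolding wreath_mult using lpos_I[OF x] by (auto intro!: restrict_ext)
  finally show ?case .
qed

lemma Theta_eq_iff:
  assumes "u \<in> lists X" "v \<in> lists X"
  shows "Theta M n \<psi> u = Theta M n \<psi> v \<longleftrightarrow> u \<approx> v"
proof
  assume "Theta M n \<psi> u = Theta M n \<psi> v"
  then have "\<forall>p\<in>I. lab u p = lab v p \<and> pos u p = pos v p"
    unfolding Theta_eq[OF assms(1)] Theta_eq[OF assms(2)] by (metis prod.inject restrict_apply')
  then show "u \<approx> v" using word_eqvI assms by blast
next
  assume "u \<approx> v"
  then show "Theta M n \<psi> u = Theta M n \<psi> v"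
    unfolding Theta_eq[OF assms(1)] Theta_eq[OF assms(2)] using eqv_pos eqv_lab by (auto intro!: restrict_ext)
qed

lemma Theta_append:
  assumes "u \<in> lists X" "v \<in> lists X"
  shows "Theta M n \<psi> (u @ v) = Theta M n \<psi> u \<otimes>\<^bsub>T\<^esub> Theta M n \<psi> v"
  using assms pos_I[OF assms(1)] by (auto simp: Theta_eq wreath_mult intro!: restrict_ext)

abbreviation E :: "((nat \<Rightarrow> 'a) \<times> (nat \<Rightarrow> nat)) set"
  where "E \<equiv> subsemigroup_gen T (idempotents T)"

lemma coord_elt_in_E:
  assumes "i \<in> I" "b \<in> subsemigroup_gen M (idempotents M)"
  shows "coord_elt M n i b \<in> E"
  using assms(2)
proof induction
  case (gen b)
  then have "b \<in> carrier M" "b \<otimes> b = b" by (auto simp: idempotents_def)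
  then have "coord_elt M n i b \<in> idempotents T"
    by (auto simp: idempotents_def coord_elt_eq wreath_carrier wreath_mult intro!: restrict_ext)
  then show ?case by (rule subsemigroup_gen.gen)
next
  case (mult b c)
  have "b \<in> carrier M" "c \<in> carrier M" by (rule subsemigroup_gen_carrier[OF monoid_axioms mult(1)], rule subsemigroup_gen_carrier[OF monoid_axioms mult(2)])
  then have "coord_elt M n i (b \<otimes> c) = coord_elt M n i b \<otimes>\<^bsub>T\<^esub> coord_elt M n i c"
    by (auto simp: coord_elt_eq wreath_mult intro!: restrict_ext)
  then show ?case using mult subsemigroup_gen.mult by simp
qed

lemma eps_elt_in_E:
  assumes "i \<in> I" "j \<in> I" "i \<noteq> j" "a \<in> carrier M"
  shows "eps_elt M n i j a \<in> E"
proof (rule subsemigroup_gen.gen)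
  show "eps_elt M n i j a \<in> idempotents T"
    using assms
    by (auto simp: idempotents_def eps_elt_eq wreath_carrier wreath_mult intro!: restrict_ext)
qed

lemma Theta_in_E: "w \<in> lists X \<Longrightarrow> Theta M n \<psi> w \<in> E"
proof (induction w)
  case Nil
  have "\<one>\<^bsub>T\<^esub> \<in> idempotents T"
    using monoid_wreath by (simp add: idempotents_def monoid.one_closed monoid.l_one)
  then show ?case by (auto simp: Theta_def word_hom_def idem_gen_def intro: subsemigroup_gen.gen)
next
  case (Cons x w)
  have "Theta_letter M n \<psi> x \<in> E"
  proof (cases x)
    case (Yl i y)
    then show ?thesis using Cons.prems psi_in[of "[y]"] by (auto simp: idem_gen_def intro!: coord_elt_in_E)
  next
    case (El i j a)
    then show ?thesis using Cons.prems by (auto intro!: eps_elt_in_E)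
  qed
  moreover have "Theta M n \<psi> (x # w) = Theta_letter M n \<psi> x \<otimes>\<^bsub>T\<^esub> Theta M n \<psi> w"
    by (simp add: Theta_def word_hom_def idem_gen_def)
  ultimately show ?case using Cons subsemigroup_gen.mult by simp
qed

text \<open>The nonunit coordinates are supplied by a word over the copies of \<open>Y\<close>, the
  map and the unit coordinates by a word over \<open>X1\<close>. The latter needs
  \<open>\<alpha>\<close> to be noninjective.\<close>

lemma idempotent_in_image:
  assumes "t \<in> idempotents T"
  shows "t \<in> Theta M n \<psi> ` lists X"
proof -
  obtain a \<alpha> where t: "t = (a, \<alpha>)" and a: "a \<in> I \<rightarrow>\<^sub>E carrier M" and \<alpha>: "\<alpha> \<in> I \<rightarrow>\<^sub>E I"
    and id: "(\<lambda>i\<in>I. a i \<otimes> a (\<alpha> i), \<lambda>i\<in>I. \<alpha> (\<alpha> i)) = (a, \<alpha>)"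
    using assms by (auto simp: idempotents_def wreath_carrier wreath_mult)
  have id: "(\<lambda>i\<in>I. a i \<otimes> a (\<alpha> i)) = a" "(\<lambda>i\<in>I. \<alpha> (\<alpha> i)) = \<alpha>" using id by simp_all
  have aM: "a i \<in> carrier M" and aI: "\<alpha> i \<in> I" and id': "a i \<otimes> a (\<alpha> i) = a i" "\<alpha> (\<alpha> i) = \<alpha> i" if "i \<in> I" for i
    using that a \<alpha> fun_cong[OF id(1), of i] fun_cong[OF id(2), of i] by auto
  have Theta: "t = Theta M n \<psi> w" if "w \<in> lists X" "\<And>i. i \<in> I \<Longrightarrow> lab w i = a i \<and> pos w i = \<alpha> i" for w
    unfolding Theta_eq[OF that(1)] t using that(2) a \<alpha>
    by (auto simp: fun_eq_iff restrict_def PiE_iff extensional_def)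
  define ws where "ws i = (if i \<in> I \<and> a i \<notin> G then h (a i) else [])" for i
  have ws: "ws i \<in> lists Y" "i \<in> I \<Longrightarrow> \<psi> (ws i) = (if a i \<in> G then \<one> else a i)" for i
    using h_nonunit aM by (auto simp: ws_def)
  define y where "y = cprod ws points"
  have y: "y \<in> lists YY" using ws cprod_YY by (simp add: y_def)
  have laby: "lab y i = (if a i \<in> G then \<one> else a i)" if "i \<in> I" for i
  proof -
    have "proj i y = ws i" using that by (simp add: y_def proj_cprod)
    then show ?thesis using that ws by (simp add: lab_YY[OF y])
  qed
  show ?thesis
  proof (cases "inj_on \<alpha> I")
    case True
    \<comment> \<open>An injective idempotent map is the identity. Every coordinate is then
      idempotent, and an idempotent unit is 1, so the word over the copies of \<open>Y\<close>
      suffices.\<close>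
    then have fixed: "\<alpha> i = i" if "i \<in> I" for i using that id'(2) aI by (meson inj_onD)
    have "a i = \<one>" if "i \<in> I" "a i \<in> G" for i
      using that id'(1)[of i] fixed[of i] aM by (metis Units_l_cancel one_closed r_one)
    then show ?thesis
      using y Theta[of y] laby fixed YY_X by (auto simp: pos_YY)
  next
    case False
    define g where "g i = (if i \<in> I \<and> a i \<in> G then a i else \<one>)" for i
    have "range g \<subseteq> G" by (auto simp: g_def)
    then obtain x where x: "x \<in> lists X1" "\<forall>p\<in>I. pos x p = \<alpha> p \<and> lab x p = g p"
      using unit_maps_reach[of \<alpha> g] False aI by blast
    have "t = Theta M n \<psi> (y @ x)"
    proof (rule Theta)
      show "y @ x \<in> lists X" using YY_X[OF y] X1_X[OF x(1)] by simp
      show "lab (y @ x) i = a i \<and> pos (y @ x) i = \<alpha> i" if "i \<in> I" for i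
        using that YY_X[OF y] X1_X[OF x(1)] x(2) laby aM by (simp add: pos_YY[OF y] g_def)
    qed
    then show ?thesis using YY_X[OF y] X1_X[OF x(1)] by simp
  qed
qed

lemma Theta_image: "Theta M n \<psi> ` lists X = E"
proof
  show "E \<subseteq> Theta M n \<psi> ` lists X"
  proof
    fix t assume "t \<in> E"
    then show "t \<in> Theta M n \<psi> ` lists X"
    proof induction
      case (gen t)
      then show ?case by (rule idempotent_in_image)
    next
      case (mult s t)
      then obtain u v where "u \<in> lists X" "v \<in> lists X" "s = Theta M n \<psi> u" "t = Theta M n \<psi> v" by blast
      then show ?case using Theta_append[of u v] by (intro image_eqI[of _ _ "u @ v"]) auto
    qed
  qed
qed (auto intro: Theta_in_E)

lemma wreath_presentation_idem_gen: "monoid_presentation (idem_gen T) X R (Theta M n \<psi>)"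
  unfolding monoid_presentation_def
proof (intro conjI)
  show "monoid (idem_gen T)" by (intro monoid_idem_gen monoid_wreath)
  show "R \<subseteq> lists X \<times> lists X" using R_sound by (intro subrelI) blast
  show "Theta M n \<psi> \<in> hom (free_monoid X) (idem_gen T)"
    using Theta_in_E Theta_append by (auto simp: hom_def free_monoid_def idem_gen_def)
  show "Theta M n \<psi> [] = \<one>\<^bsub>idem_gen T\<^esub>" by (simp add: Theta_def word_hom_def)
  show "Theta M n \<psi> ` lists X = carrier (idem_gen T)" using Theta_image by (simp add: idem_gen_def)
  have "(u, v) \<in> word_congruence X R \<longleftrightarrow> u \<in> lists X \<and> v \<in> lists X \<and> Theta M n \<psi> u = Theta M n \<psi> v" for u v
    using Theta_eq_iff eqv_lists unfolding eqv_def[symmetric] by blast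
  then show "{(u, v). u \<in> lists X \<and> v \<in> lists X \<and> Theta M n \<psi> u = Theta M n \<psi> v} = word_congruence X R"
    by auto
qed

end

theorem theorem6p3:
  fixes M :: "('a, 'm) monoid_scheme"
    and n :: nat
    and Y :: "'y set"
    and Q :: "('y list \<times> 'y list) set"
    and \<psi> :: "'y list \<Rightarrow> 'a"
    and h :: "'a \<Rightarrow> 'y list"
  assumes "n \<ge> 2"
    and "monoid M"
    and "carrier (idem_gen M) = {\<one>\<^bsub>M\<^esub>} \<union> (carrier M - Units M)"
    and "monoid_presentation (idem_gen M) Y Q \<psi>"
    and "\<And>y. y \<in> Y \<Longrightarrow> \<psi> [y] \<noteq> \<one>\<^bsub>M\<^esub>"
    and "\<And>a. a \<in> carrier (idem_gen M) \<Longrightarrow> h a \<in> lists Y \<and> \<psi> (h a) = a"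
  shows "monoid_presentation (idem_gen (wreath M n))
    (Y_letters n Y \<union> X1_letters M n)
    (Q_rels n Q \<union> R_comm n Y \<union> R1' M n \<union> R_nabla M n Y \<psi> h)
    (Theta M n \<psi>)"
proof -
  interpret wreath_presentation M n Y Q \<psi> h
    using assms by (intro wreath_presentation.intro wreath_presentation_axioms.intro)
  show ?thesis using wreath_presentation_idem_gen by (simp add: X_def)
qed

end
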